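(* Let $n\ge1$ and let $\mathcal H$ be a Hilbert space. If $u$ is a positive free pluriharmonic function on $[B(\mathcal H)^n]_1$ with operator-valued coefficients in $B(\mathcal E)$ and $0\le r<1$, then $$u(0)\,\frac{1-r}{1+r}\le u(X_1,\ldots,X_n)\le u(0)\,\frac{1+r}{1-r}$$ for any $(X_1,\ldots,X_n)\in[B(\mathcal H)^n]_r^-$.
   Context: $[B(\mathcal H)^n]_1$ is the set of $X=(X_1,\ldots,X_n)\in B(\mathcal H)^n$ with $\|X_1X_1^*+\cdots+X_nX_n^*\|^{1/2}<1$, and $[B(\mathcal H)^n]_r^-$ is the set of $X$ with $\|X_1X_1^*+\cdots+X_nX_n^*\|^{1/2}\le r$. $\mathbb F_n^+$ is the free unital semigroup on $g_1,\ldots,g_n$ with identity $g_0$; for $\alpha=g_{i_1}\cdots g_{i_k}$, $|\alpha|=k$ and $X_\alpha:=X_{i_1}\cdots X_{i_k}$; $|g_0|=0$, $X_{g_0}=I$. A free holomorphic function with coefficients in $B(\mathcal E)$ ($\mathcal E$ a separable Hilbert space) is a map $f(X)=\sum_{k=0}^\infty\sum_{|\alpha|=k}X_\alpha\otimes A_{(\alpha)}$, $X\in[B(\mathcal K)^n]_1$ ($\mathcal K$ any Hilbert space), where $A_{(\alpha)}\in B(\mathcal E)$ satisfy $\limsup_k\|\sum_{|\alpha|=k}A_{(\alpha)}^*A_{(\alpha)}\|^{1/2k}\le1$ (the series converges in norm). A (self-adjoint) free pluriharmonic function is $u=\mathrm{Re}\,f:=\frac12(f+f^* )$ with $f$ free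 holomorphic; it is positive if $u(X)\ge0$ for all $X\in[B(\mathcal K)^n]_1$ and all Hilbert spaces $\mathcal K$. Here $u(0)=I_{\mathcal H}\otimes\mathrm{Re}\,A_{(g_0)}$. *)

theory Defs
  imports "HOL-Analysis.Analysis" "HOL-Algebra.Module"
begin

section \<open>Complex Hilbert spaces\<close>

text \<open>Hilbert spaces are structures with an explicit carrier set, so that a formula can
  quantify over all Hilbert spaces carried by subsets of a given type.\<close>

definition complex_field :: "complex ring" where
  "complex_field = \<lparr>carrier = UNIV, monoid.mult = (*), one = 1, ring.zero = 0, add = (+)\<rparr>"

text \<open>The record \<open>module\<close> inherits from \<open>ring\<close>; the fields \<open>mult\<close> and \<open>one\<close> play no role in a
  Hilbert space.\<close>

record 'a hilb = "(complex, 'a) module" +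
  cinner :: "'a \<Rightarrow> 'a \<Rightarrow> complex"

definition hnorm :: "'a hilb \<Rightarrow> 'a \<Rightarrow> real" where
  "hnorm V x = sqrt (Re (cinner V x x))"

text \<open>The guard is needed because the locale \<open>Metric_space\<close> demands a symmetric nonnegative
  function on the whole type.\<close>

definition hdist :: "'a hilb \<Rightarrow> 'a \<Rightarrow> 'a \<Rightarrow> real" where
  "hdist V x y = (if x \<in> carrier V \<and> y \<in> carrier V then hnorm V (x \<ominus>\<^bsub>V\<^esub> y) else 0)"

text \<open>The inner product is linear in its first argument.\<close>

locale hilbert_space = module complex_field V for V :: "'a hilb" (structure) +
  assumes cinner_add: "\<lbrakk>x \<in> carrier V; y \<in> carrier V; z \<in> carrier V\<rbrakk> \<Longrightarrow>
      cinner V (x \<oplus>\<^bsub>V\<^esub> y) z = cinner V x z + cinner V y z"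
    and cinner_smult: "\<lbrakk>x \<in> carrier V; y \<in> carrier V\<rbrakk> \<Longrightarrow>
      cinner V (a \<odot>\<^bsub>V\<^esub> x) y = a * cinner V x y"
    and cinner_commute: "\<lbrakk>x \<in> carrier V; y \<in> carrier V\<rbrakk> \<Longrightarrow>
      cinner V y x = cnj (cinner V x y)"
    and cinner_pos: "\<lbrakk>x \<in> carrier V; x \<noteq> \<zero>\<^bsub>V\<^esub>\<rbrakk> \<Longrightarrow> 0 < Re (cinner V x x)"
    and complete: "Metric_space.mcomplete (carrier V) (hdist V)"

definition separable_hilbert_space :: "'a hilb \<Rightarrow> bool" where
  "separable_hilbert_space V \<longleftrightarrow>
     hilbert_space V \<and> separable_space (Metric_space.mtopology (carrier V) (hdist V))"

definition orthonormal_basis :: "'a hilb \<Rightarrow> 'a set \<Rightarrow> bool" where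
  "orthonormal_basis V B \<longleftrightarrow> B \<subseteq> carrier V \<and>
     (\<forall>b\<in>B. \<forall>c\<in>B. cinner V b c = (if b = c then 1 else 0)) \<and>
     (\<forall>x\<in>carrier V. (\<forall>b\<in>B. cinner V x b = 0) \<longrightarrow> x = \<zero>\<^bsub>V\<^esub>)"

definition some_basis :: "'a hilb \<Rightarrow> 'a set" where
  "some_basis V = (SOME B. orthonormal_basis V B)"


section \<open>Bounded operators\<close>

text \<open>An operator is undefined outside the carrier, so that equality of operators is equality of
  functions.\<close>

definition bounded_ops :: "'a hilb \<Rightarrow> (complex, 'a \<Rightarrow> 'a) module" where
  "bounded_ops V =
    \<lparr>carrier = {T \<in> carrier V \<rightarrow>\<^sub>E carrier V.
        (\<forall>x\<in>carrier V. \<forall>y\<in>carrier V. T (x \<oplus>\<^bsub>V\<^esub> y) = T x \<oplus>\<^bsub>V\<^esub> T y) \<and>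
        (\<forall>a. \<forall>x\<in>carrier V. T (a \<odot>\<^bsub>V\<^esub> x) = a \<odot>\<^bsub>V\<^esub> T x) \<and>
        (\<exists>c. \<forall>x\<in>carrier V. hnorm V (T x) \<le> c * hnorm V x)},
     monoid.mult = (\<lambda>S T. compose (carrier V) S T),
     one = (\<lambda>x\<in>carrier V. x),
     ring.zero = (\<lambda>x\<in>carrier V. \<zero>\<^bsub>V\<^esub>),
     add = (\<lambda>S T. \<lambda>x\<in>carrier V. S x \<oplus>\<^bsub>V\<^esub> T x),
     smult = (\<lambda>a T. \<lambda>x\<in>carrier V. a \<odot>\<^bsub>V\<^esub> T x)\<rparr>"

definition opnorm :: "'a hilb \<Rightarrow> ('a \<Rightarrow> 'a) \<Rightarrow> real" where
  "opnorm V T = (SUP x\<in>{x \<in> carrier V. hnorm V x \<le> 1}. hnorm V (T x))"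

definition adj :: "'a hilb \<Rightarrow> ('a \<Rightarrow> 'a) \<Rightarrow> ('a \<Rightarrow> 'a)" where
  "adj V T = (THE S. S \<in> carrier (bounded_ops V) \<and>
     (\<forall>x\<in>carrier V. \<forall>y\<in>carrier V. cinner V (T x) y = cinner V x (S y)))"

definition positive_op :: "'a hilb \<Rightarrow> ('a \<Rightarrow> 'a) \<Rightarrow> bool" where
  "positive_op V T \<longleftrightarrow> T \<in> carrier (bounded_ops V) \<and>
     (\<forall>x\<in>carrier V. Im (cinner V (T x) x) = 0 \<and> 0 \<le> Re (cinner V (T x) x))"

definition op_le :: "'a hilb \<Rightarrow> ('a \<Rightarrow> 'a) \<Rightarrow> ('a \<Rightarrow> 'a) \<Rightarrow> bool" where
  "op_le V S T \<longleftrightarrow> S \<in> carrier (bounded_ops V) \<and> T \<in> carrier (bounded_ops V) \<and>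
     positive_op V (T \<ominus>\<^bsub>bounded_ops V\<^esub> S)"


section \<open>Hilbert space tensor product\<close>

text \<open>The tensor product of \<open>K\<close> and \<open>E\<close> is realised as the space of conjugate-linear
  Hilbert--Schmidt maps from \<open>E\<close> to \<open>K\<close> (as in Folland, A Course in Abstract Harmonic Analysis,
  Section 7.3), where \<open>\<langle>S, T\<rangle> = \<Sum>b. \<langle>S b, T b\<rangle>\<close> for \<open>b\<close> ranging over an orthonormal basis of \<open>E\<close>;
  neither the space nor the inner product depends on the basis. The simple tensor of
  \<open>x\<close> and \<open>y\<close> is the map \<open>v \<mapsto> \<langle>y, v\<rangle> x\<close>.\<close>

definition hilb_tensor :: "'k hilb \<Rightarrow> 'e hilb \<Rightarrow> ('e \<Rightarrow> 'k) hilb" where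
  "hilb_tensor K E =
    \<lparr>carrier = {S \<in> carrier E \<rightarrow>\<^sub>E carrier K.
        (\<forall>x\<in>carrier E. \<forall>y\<in>carrier E. S (x \<oplus>\<^bsub>E\<^esub> y) = S x \<oplus>\<^bsub>K\<^esub> S y) \<and>
        (\<forall>a. \<forall>x\<in>carrier E. S (a \<odot>\<^bsub>E\<^esub> x) = cnj a \<odot>\<^bsub>K\<^esub> S x) \<and>
        (\<exists>c. \<forall>x\<in>carrier E. hnorm K (S x) \<le> c * hnorm E x) \<and>
        (\<lambda>b. (hnorm K (S b))\<^sup>2) summable_on some_basis E},
     monoid.mult = undefined,
     one = undefined,
     ring.zero = (\<lambda>x\<in>carrier E. \<zero>\<^bsub>K\<^esub>),
     add = (\<lambda>S T. \<lambda>x\<in>carrier E. S x \<oplus>\<^bsub>K\<^esub> T x),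
     smult = (\<lambda>a S. \<lambda>x\<in>carrier E. a \<odot>\<^bsub>K\<^esub> S x),
     cinner = (\<lambda>S T. \<Sum>\<^sub>\<infinity>b\<in>some_basis E. cinner K (S b) (T b))\<rparr>"

text \<open>The operator \<open>X \<otimes> A\<close> maps \<open>S\<close> to \<open>X \<circ> S \<circ> A\<^sup>*\<close>: on the simple tensor of \<open>x\<close> and \<open>y\<close> this is
  \<open>v \<mapsto> \<langle>y, A\<^sup>* v\<rangle> X x = \<langle>A y, v\<rangle> X x\<close>, the simple tensor of \<open>X x\<close> and \<open>A y\<close>.\<close>

definition op_tensor ::
    "'k hilb \<Rightarrow> 'e hilb \<Rightarrow> ('k \<Rightarrow> 'k) \<Rightarrow> ('e \<Rightarrow> 'e) \<Rightarrow> (('e \<Rightarrow> 'k) \<Rightarrow> ('e \<Rightarrow> 'k))" where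
  "op_tensor K E X A =
     (\<lambda>S\<in>carrier (hilb_tensor K E). \<lambda>v\<in>carrier E. X (S (adj E A v)))"


section \<open>Operator tuples and words\<close>

definition op_tuples :: "nat \<Rightarrow> 'k hilb \<Rightarrow> (nat \<Rightarrow> 'k \<Rightarrow> 'k) set" where
  "op_tuples n K = {1..n} \<rightarrow>\<^sub>E carrier (bounded_ops K)"

definition zero_tuple :: "nat \<Rightarrow> 'k hilb \<Rightarrow> (nat \<Rightarrow> 'k \<Rightarrow> 'k)" where
  "zero_tuple n K = (\<lambda>i\<in>{1..n}. \<zero>\<^bsub>bounded_ops K\<^esub>)"

definition row_norm :: "nat \<Rightarrow> 'k hilb \<Rightarrow> (nat \<Rightarrow> 'k \<Rightarrow> 'k) \<Rightarrow> real" where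
  "row_norm n K X =
     sqrt (opnorm K (\<Oplus>\<^bsub>bounded_ops K\<^esub>i\<in>{1..n}. X i \<otimes>\<^bsub>bounded_ops K\<^esub> adj K (X i)))"

definition open_op_ball :: "nat \<Rightarrow> 'k hilb \<Rightarrow> (nat \<Rightarrow> 'k \<Rightarrow> 'k) set" where
  "open_op_ball n K = {X \<in> op_tuples n K. row_norm n K X < 1}"

definition closed_op_ball :: "nat \<Rightarrow> 'k hilb \<Rightarrow> real \<Rightarrow> (nat \<Rightarrow> 'k \<Rightarrow> 'k) set" where
  "closed_op_ball n K r = {X \<in> op_tuples n K. row_norm n K X \<le> r}"

text \<open>The word \<open>g\<^sub>i\<^sub>1 \<dots> g\<^sub>i\<^sub>k\<close> of the free semigroup is the list \<open>[i\<^sub>1, \<dots>, i\<^sub>k]\<close>.\<close>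

definition words :: "nat \<Rightarrow> nat \<Rightarrow> nat list set" where
  "words n k = {\<alpha>. set \<alpha> \<subseteq> {1..n} \<and> length \<alpha> = k}"

fun word_op :: "'k hilb \<Rightarrow> (nat \<Rightarrow> 'k \<Rightarrow> 'k) \<Rightarrow> nat list \<Rightarrow> ('k \<Rightarrow> 'k)" where
  "word_op K X [] = \<one>\<^bsub>bounded_ops K\<^esub>"
| "word_op K X (i # \<alpha>) = X i \<otimes>\<^bsub>bounded_ops K\<^esub> word_op K X \<alpha>"


section \<open>Free holomorphic and free pluriharmonic functions\<close>

text \<open>A free function with coefficients in \<open>B(E)\<close> assigns to a Hilbert space \<open>K\<close> and a tuple of
  operators on \<open>K\<close> an operator on \<open>K \<otimes> E\<close>.\<close>

type_synonym ('k, 'e) free_function =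
  "'k hilb \<Rightarrow> (nat \<Rightarrow> 'k \<Rightarrow> 'k) \<Rightarrow> (('e \<Rightarrow> 'k) \<Rightarrow> ('e \<Rightarrow> 'k))"

definition homogeneous_part ::
    "nat \<Rightarrow> 'e hilb \<Rightarrow> (nat list \<Rightarrow> 'e \<Rightarrow> 'e) \<Rightarrow> nat \<Rightarrow> ('k, 'e) free_function" where
  "homogeneous_part n E A k K X =
     (\<Oplus>\<^bsub>bounded_ops (hilb_tensor K E)\<^esub>\<alpha>\<in>words n k. op_tensor K E (word_op K X \<alpha>) (A \<alpha>))"

definition free_coefficients :: "nat \<Rightarrow> 'e hilb \<Rightarrow> (nat list \<Rightarrow> 'e \<Rightarrow> 'e) \<Rightarrow> bool" where
  "free_coefficients n E A \<longleftrightarrow>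
     (\<forall>k. \<forall>\<alpha>\<in>words n k. A \<alpha> \<in> carrier (bounded_ops E)) \<and>
     limsup (\<lambda>k. ereal (opnorm E
        (\<Oplus>\<^bsub>bounded_ops E\<^esub>\<alpha>\<in>words n k. adj E (A \<alpha>) \<otimes>\<^bsub>bounded_ops E\<^esub> A \<alpha>)
          powr (1 / (2 * real k)))) \<le> 1"

definition free_holomorphic :: "nat \<Rightarrow> 'e hilb \<Rightarrow> ('k, 'e) free_function \<Rightarrow> bool" where
  "free_holomorphic n E f \<longleftrightarrow>
     (\<exists>A. free_coefficients n E A \<and>
       (\<forall>K. hilbert_space K \<longrightarrow> (\<forall>X\<in>open_op_ball n K.
          f K X \<in> carrier (bounded_ops (hilb_tensor K E)) \<and>
          (\<lambda>N. opnorm (hilb_tensor K E)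
             (f K X \<ominus>\<^bsub>bounded_ops (hilb_tensor K E)\<^esub>
               (\<Oplus>\<^bsub>bounded_ops (hilb_tensor K E)\<^esub>k\<in>{..<N}. homogeneous_part n E A k K X)))
          \<longlonglongrightarrow> 0)))"

definition free_pluriharmonic :: "nat \<Rightarrow> 'e hilb \<Rightarrow> ('k, 'e) free_function \<Rightarrow> bool" where
  "free_pluriharmonic n E u \<longleftrightarrow>
     (\<exists>f :: ('k, 'e) free_function. free_holomorphic n E f \<and>
       (\<forall>K. hilbert_space K \<longrightarrow> (\<forall>X\<in>open_op_ball n K.
          u K X = (1/2) \<odot>\<^bsub>bounded_ops (hilb_tensor K E)\<^esub>
            (f K X \<oplus>\<^bsub>bounded_ops (hilb_tensor K E)\<^esub> adj (hilb_tensor K E) (f K X)))))"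

definition positive_free_function :: "nat \<Rightarrow> 'e hilb \<Rightarrow> ('k, 'e) free_function \<Rightarrow> bool" where
  "positive_free_function n E u \<longleftrightarrow>
     (\<forall>K. hilbert_space K \<longrightarrow>
       (\<forall>X\<in>open_op_ball n K. positive_op (hilb_tensor K E) (u K X)))"

end

(* For a vector S, the function h(z) = <u(zX) S, S> is a positive harmonic function on the disc
   |z| < 1/r: it is the real part of the power series whose k-th coefficient is <f_k(X) S, S>, with
   f_k the homogeneous parts of f, because f_k(zX) = z^k f_k(X). The classical Harnack inequality at
   z = 1 gives both operator inequalities. It follows from the Schwarz lemma applied to
   (G - c) / (G + c), where Re G > 0 and G(0) = c > 0. To treat r = 0 uniformly, the disc
   |z| < 1/s is used for r < s < 1, with s tending to r.

   The adjoint of f(X) exists by Riesz representation on K (x) E, so one has to know that the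
   conjugate-linear Hilbert-Schmidt maps form a Hilbert space, on which the operators X (x) A act
   boundedly. *)

theory Submission
  imports Defs "HOL-Complex_Analysis.Conformal_Mappings"
begin

text \<open>The norm on the tensor product samples a map S only on one chosen basis of E, while the
  arguments about it keep leaving that basis: definiteness concerns S v for every v, and X (x) A
  replaces S by a map precomposed with \<open>adj E A\<close>. The remedy is the conjugate-linear
  adjoint S' from K to E, with <y, S v> = <v, S' y>. Parseval for S' y bounds S v by the
  Hilbert-Schmidt norm for all v, which yields definiteness and pointwise limits of Cauchy
  sequences. Passing to S' also turns composition with \<open>adj E A\<close> on the right into
  composition with A on the left, where \<open>opnorm E A\<close> comes out term by term. The
  quadratic form of a positive operator is real, so each operator inequality is one scalar
  inequality per vector; this is why a one-variable theorem is enough. Positivity of u gives only Re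
  >= 0 and leaves the imaginary part of f at the centre free, so the Schwarz lemma is applied to a
  perturbed function and the perturbation is then sent to 0.\<close>

lemma complex_field_simps [simp]:
  "carrier complex_field = UNIV" "a \<otimes>\<^bsub>complex_field\<^esub> b = a * b"
  "\<one>\<^bsub>complex_field\<^esub> = 1" "\<zero>\<^bsub>complex_field\<^esub> = 0" "a \<oplus>\<^bsub>complex_field\<^esub> b = a + b"
  by (simp_all add: complex_field_def)

lemma cring_complex_field: "cring complex_field"
proof (rule cringI)
  show "abelian_group complex_field"
    by (rule abelian_groupI) (auto simp: algebra_simps intro: exI[of _ "- _"] add.right_inverse)
  show "comm_monoid complex_field"
    by (rule comm_monoidI) (auto simp: algebra_simps)
qed (auto simp: algebra_simps)

section \<open>Geometry of Hilbert spaces\<close>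

text \<open>Completeness is split off because the metric facts are needed to prove that the tensor product
  is complete.\<close>

locale pre_hilbert_space = module complex_field V for V :: "'a hilb" (structure) +
  assumes cinner_add: "\<lbrakk>x \<in> carrier V; y \<in> carrier V; z \<in> carrier V\<rbrakk> \<Longrightarrow>
      cinner V (x \<oplus> y) z = cinner V x z + cinner V y z"
    and cinner_smult: "\<lbrakk>x \<in> carrier V; y \<in> carrier V\<rbrakk> \<Longrightarrow> cinner V (a \<odot> x) y = a * cinner V x y"
    and cinner_commute: "\<lbrakk>x \<in> carrier V; y \<in> carrier V\<rbrakk> \<Longrightarrow> cinner V y x = cnj (cinner V x y)"
    and cinner_pos: "\<lbrakk>x \<in> carrier V; x \<noteq> \<zero>\<rbrakk> \<Longrightarrow> 0 < Re (cinner V x x)"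
begin

lemma smult_in [simp, intro]: "x \<in> carrier V \<Longrightarrow> a \<odot> x \<in> carrier V"
  by (rule smult_closed) auto

lemma minus_in [simp, intro]: "\<lbrakk>x \<in> carrier V; y \<in> carrier V\<rbrakk> \<Longrightarrow> x \<ominus> y \<in> carrier V"
  by (rule minus_closed)

lemma cinner_add_right:
  assumes "x \<in> carrier V" "y \<in> carrier V" "z \<in> carrier V"
  shows "cinner V z (x \<oplus> y) = cinner V z x + cinner V z y"
  using cinner_add[OF assms] cinner_commute assms by (metis M.add.m_closed complex_cnj_add)

lemma cinner_smult_right:
  assumes "x \<in> carrier V" "z \<in> carrier V"
  shows "cinner V z (a \<odot> x) = cnj a * cinner V z x"
  using cinner_smult[OF assms] cinner_commute assms by (metis smult_in complex_cnj_mult)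

lemma cinner_zero_left [simp]: "z \<in> carrier V \<Longrightarrow> cinner V \<zero> z = 0"
  using cinner_add[of \<zero> \<zero> z] by simp

lemma cinner_zero_right [simp]: "z \<in> carrier V \<Longrightarrow> cinner V z \<zero> = 0"
  using cinner_add_right[of \<zero> \<zero> z] by simp

lemma cinner_diff:
  assumes "x \<in> carrier V" "y \<in> carrier V" "z \<in> carrier V"
  shows "cinner V (x \<ominus> y) z = cinner V x z - cinner V y z"
proof -
  have "cinner V (x \<ominus> y) z + cinner V y z = cinner V (x \<ominus> y \<oplus> y) z"
    using cinner_add assms by simp
  also have "x \<ominus> y \<oplus> y = x"
    using assms by (simp add: M.minus_eq M.add.m_assoc M.l_neg)
  finally show ?thesis by (simp add: algebra_simps)
qed

lemma cinner_diff_right: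
  assumes "x \<in> carrier V" "y \<in> carrier V" "z \<in> carrier V"
  shows "cinner V z (x \<ominus> y) = cinner V z x - cinner V z y"
  using cinner_diff[OF assms] cinner_commute assms by (metis minus_in complex_cnj_diff)

lemmas cinner_simps = cinner_add cinner_add_right cinner_smult cinner_smult_right
  cinner_diff cinner_diff_right

lemma Im_cinner_self: "x \<in> carrier V \<Longrightarrow> Im (cinner V x x) = 0"
  using cinner_commute[of x x] by (metis cnj.simps(2) eq_neg_iff_add_eq_0 neg_equal_zero)

lemma cinner_self_nonneg: "x \<in> carrier V \<Longrightarrow> 0 \<le> Re (cinner V x x)"
  using cinner_pos[of x] by (cases "x = \<zero>") auto

lemma cinner_self: "x \<in> carrier V \<Longrightarrow> cinner V x x = complex_of_real ((hnorm V x)\<^sup>2)"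
  by (simp add: hnorm_def cinner_self_nonneg Im_cinner_self complex_eq_iff)

lemma hnorm_sq: "x \<in> carrier V \<Longrightarrow> (hnorm V x)\<^sup>2 = Re (cinner V x x)"
  by (simp add: cinner_self)

lemma hnorm_nonneg [simp]: "x \<in> carrier V \<Longrightarrow> 0 \<le> hnorm V x"
  by (simp add: hnorm_def cinner_self_nonneg)

lemma hnorm_zero [simp]: "hnorm V \<zero> = 0"
  by (simp add: hnorm_def)

lemma hnorm_eq_0: "x \<in> carrier V \<Longrightarrow> hnorm V x = 0 \<longleftrightarrow> x = \<zero>"
  using cinner_pos[of x] by (cases "x = \<zero>") (auto simp: hnorm_def)

lemma diff_eq_zero:
  assumes "x \<in> carrier V" "y \<in> carrier V" "x \<ominus> y = \<zero>"
  shows "x = y"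
  using assms by (metis M.l_zero M.minus_eq M.add.inv_closed M.r_neg M.add.m_assoc M.l_neg M.r_zero)

text \<open>Pairing with z = x - y shows that the difference has norm 0. Vector identities thereby
  become identities of complex numbers, which \<open>cinner_simps\<close> decides, so that no
  calculation in the abstract group is needed later.\<close>

lemma vec_eqI:
  assumes "x \<in> carrier V" "y \<in> carrier V" "\<And>z. z \<in> carrier V \<Longrightarrow> cinner V x z = cinner V y z"
  shows "x = y"
proof (rule diff_eq_zero[OF assms(1,2)])
  have "hnorm V (x \<ominus> y) = 0"
    using assms by (simp add: hnorm_def cinner_diff)
  then show "x \<ominus> y = \<zero>" using assms by (simp add: hnorm_eq_0)
qed

lemma hnorm_smult:
  assumes "x \<in> carrier V" shows "hnorm V (a \<odot> x) = norm a * hnorm V x"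
proof -
  have "cinner V (a \<odot> x) (a \<odot> x) = (a * cnj a) * cinner V x x"
    using assms by (simp add: cinner_simps)
  also have "\<dots> = complex_of_real ((norm a)\<^sup>2 * (hnorm V x)\<^sup>2)"
    using assms by (simp only: complex_norm_square[symmetric] cinner_self of_real_mult of_real_power)
  finally have "hnorm V (a \<odot> x) = sqrt ((norm a)\<^sup>2 * (hnorm V x)\<^sup>2)"
    by (simp add: hnorm_def)
  then show ?thesis
    using assms by (simp add: real_sqrt_mult)
qed

lemma hnorm_add_sq:
  assumes "x \<in> carrier V" "y \<in> carrier V"
  shows "(hnorm V (x \<oplus> y))\<^sup>2 = (hnorm V x)\<^sup>2 + (hnorm V y)\<^sup>2 + 2 * Re (cinner V x y)"
  using assms cinner_commute[of x y] by (simp add: hnorm_sq cinner_simps)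

lemma hnorm_diff_sq:
  assumes "x \<in> carrier V" "y \<in> carrier V"
  shows "(hnorm V (x \<ominus> y))\<^sup>2 = (hnorm V x)\<^sup>2 + (hnorm V y)\<^sup>2 - 2 * Re (cinner V x y)"
  using assms cinner_commute[of x y] by (simp add: hnorm_sq cinner_simps)

lemma Cauchy_Schwarz:
  assumes x: "x \<in> carrier V" and y: "y \<in> carrier V"
  shows "norm (cinner V x y) \<le> hnorm V x * hnorm V y"
proof (cases "y = \<zero>")
  case True
  then show ?thesis using x by simp
next
  case False
  define c where "c = cinner V x y"
  define q where "q = (hnorm V y)\<^sup>2"
  have q: "q > 0" using False y by (simp add: q_def hnorm_eq_0)
  have yx: "cinner V y x = cnj c" using x y by (simp add: c_def cinner_commute[of x y])
  \<comment> \<open>The vector q x - c y is q times the component of x orthogonal to y; the factor q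
    clears the denominator of c / q.\<close>
  have "0 \<le> (hnorm V (complex_of_real q \<odot> x \<ominus> c \<odot> y))\<^sup>2" by simp
  also have "\<dots> = q * (q * (hnorm V x)\<^sup>2 - (norm c)\<^sup>2)"
  proof -
    have "cinner V (complex_of_real q \<odot> x \<ominus> c \<odot> y) (complex_of_real q \<odot> x \<ominus> c \<odot> y)
       = of_real q * (of_real q * cinner V x x - c * cnj c)"
      using x y by (simp add: cinner_simps yx c_def[symmetric] cinner_self[OF y] q_def[symmetric] algebra_simps)
    also have "\<dots> = of_real (q * (q * (hnorm V x)\<^sup>2 - (norm c)\<^sup>2))"
      using x by (simp add: cinner_self complex_norm_square[symmetric])
    finally show ?thesis using x y by (simp add: hnorm_sq)
  qed
  finally have "(norm c)\<^sup>2 \<le> (hnorm V x * hnorm V y)\<^sup>2"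
    using q by (simp add: zero_le_mult_iff power_mult_distrib q_def mult.commute)
  then show ?thesis
    unfolding c_def using x y by (rule_tac power2_le_imp_le) auto
qed

lemma hnorm_triangle:
  assumes x: "x \<in> carrier V" and y: "y \<in> carrier V"
  shows "hnorm V (x \<oplus> y) \<le> hnorm V x + hnorm V y"
proof (rule power2_le_imp_le)
  have "Re (cinner V x y) \<le> hnorm V x * hnorm V y"
    using Cauchy_Schwarz[OF x y] complex_Re_le_cmod order_trans by blast
  then show "(hnorm V (x \<oplus> y))\<^sup>2 \<le> (hnorm V x + hnorm V y)\<^sup>2"
    using assms by (simp add: hnorm_add_sq power2_sum)
qed (use assms in simp)

lemma hnorm_diff_commute:
  assumes x: "x \<in> carrier V" and y: "y \<in> carrier V"
  shows "hnorm V (x \<ominus> y) = hnorm V (y \<ominus> x)"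
proof -
  have "x \<ominus> y = (-1) \<odot> (y \<ominus> x)"
    by (rule vec_eqI) (use assms in \<open>auto simp: cinner_simps\<close>)
  then show ?thesis using assms by (simp add: hnorm_smult)
qed

lemma hnorm_diff_triangle:
  assumes x: "x \<in> carrier V" and y: "y \<in> carrier V" and z: "z \<in> carrier V"
  shows "hnorm V (x \<ominus> z) \<le> hnorm V (x \<ominus> y) + hnorm V (y \<ominus> z)"
proof -
  have "x \<ominus> z = (x \<ominus> y) \<oplus> (y \<ominus> z)"
    by (rule vec_eqI) (use assms in \<open>auto simp: cinner_simps\<close>)
  then show ?thesis using assms hnorm_triangle by auto
qed

lemma hnorm_le_diff:
  assumes x: "x \<in> carrier V" and y: "y \<in> carrier V"
  shows "hnorm V x \<le> hnorm V (x \<ominus> y) + hnorm V y"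
proof -
  have "x = (x \<ominus> y) \<oplus> y"
    by (rule vec_eqI) (use assms in \<open>auto simp: cinner_simps\<close>)
  then show ?thesis using assms hnorm_triangle by (metis minus_in)
qed

text \<open>This is the parallelogram law with the square of the difference dropped. It provides the
  summable majorant for a sum of two Hilbert-Schmidt maps.\<close>

lemma hnorm_sq_add_le:
  assumes x: "x \<in> carrier V" and y: "y \<in> carrier V"
  shows "(hnorm V (x \<oplus> y))\<^sup>2 \<le> 2 * (hnorm V x)\<^sup>2 + 2 * (hnorm V y)\<^sup>2"
proof -
  have "0 \<le> (hnorm V (x \<ominus> y))\<^sup>2" by simp
  then show ?thesis
    using assms by (simp add: hnorm_add_sq hnorm_diff_sq)
qed

lemma hdist_eq: "\<lbrakk>x \<in> carrier V; y \<in> carrier V\<rbrakk> \<Longrightarrow> hdist V x y = hnorm V (x \<ominus> y)"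
  by (simp add: hdist_def)

lemma Metric_space_hdist: "Metric_space (carrier V) (hdist V)"
proof
  fix x y z assume xyz: "x \<in> carrier V" "y \<in> carrier V" "z \<in> carrier V"
  show "hdist V x y = 0 \<longleftrightarrow> x = y"
    using xyz diff_eq_zero by (auto simp: hdist_eq hnorm_eq_0 M.minus_eq M.r_neg)
  show "hdist V x z \<le> hdist V x y + hdist V y z"
    using xyz hnorm_diff_triangle by (simp add: hdist_eq)
next
  fix x y show "0 \<le> hdist V x y" by (simp add: hdist_def)
  show "hdist V x y = hdist V y x" by (simp add: hdist_def hnorm_diff_commute)
qed

lemma tendsto_hnorm:
  assumes x: "\<And>n::nat. x n \<in> carrier V" and l: "l \<in> carrier V"
    and lim: "(\<lambda>n. hnorm V (x n \<ominus> l)) \<longlonglongrightarrow> 0"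
  shows "(\<lambda>n. hnorm V (x n)) \<longlonglongrightarrow> hnorm V l"
proof (rule Lim_transform[OF tendsto_const])
  show "(\<lambda>n. hnorm V (x n) - hnorm V l) \<longlonglongrightarrow> 0"
  proof (rule tendsto_rabs_zero_cancel, rule tendsto_sandwich[OF _ _ tendsto_const lim])
    show "\<forall>\<^sub>F n in sequentially. \<bar>hnorm V (x n) - hnorm V l\<bar> \<le> hnorm V (x n \<ominus> l)"
      using hnorm_le_diff[OF x l] hnorm_le_diff[OF l x] hnorm_diff_commute[OF l x]
      by (auto simp: abs_le_iff algebra_simps intro!: always_eventually)
  qed auto
qed

lemma tendsto_cinner:
  assumes x: "\<And>n::nat. x n \<in> carrier V" and l: "l \<in> carrier V" and y: "y \<in> carrier V"
    and lim: "(\<lambda>n. hnorm V (x n \<ominus> l)) \<longlonglongrightarrow> 0"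
  shows "(\<lambda>n. cinner V (x n) y) \<longlonglongrightarrow> cinner V l y"
proof (rule Lim_transform[OF tendsto_const])
  have "(\<lambda>n. hnorm V (x n \<ominus> l) * hnorm V y) \<longlonglongrightarrow> 0"
    using tendsto_mult_right[OF lim, of "hnorm V y"] by simp
  then show "(\<lambda>n. cinner V (x n) y - cinner V l y) \<longlonglongrightarrow> 0"
    by (rule Lim_null_comparison[rotated])
       (use Cauchy_Schwarz[of "x _ \<ominus> l" y] x l y
         in \<open>auto simp: cinner_diff intro!: always_eventually\<close>)
qed

lemma mcompleteI:
  assumes "\<And>x. \<lbrakk>\<And>n::nat. x n \<in> carrier V; \<And>e. e > 0 \<Longrightarrow> \<exists>N. \<forall>m\<ge>N. \<forall>n\<ge>N. hnorm V (x m \<ominus> x n) < e\<rbrakk> \<Longrightarrow>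
    \<exists>l\<in>carrier V. (\<lambda>n. hnorm V (x n \<ominus> l)) \<longlonglongrightarrow> 0"
  shows "Metric_space.mcomplete (carrier V) (hdist V)"
proof -
  interpret MS: Metric_space "carrier V" "hdist V" by (rule Metric_space_hdist)
  show ?thesis
    unfolding MS.mcomplete_def
  proof (intro allI impI)
    fix x assume C: "MS.MCauchy x"
    then have x: "\<And>n. x n \<in> carrier V" by (auto simp: MS.MCauchy_def)
    have "\<exists>l\<in>carrier V. (\<lambda>n. hnorm V (x n \<ominus> l)) \<longlonglongrightarrow> 0"
    proof (rule assms[OF x])
      fix e :: real assume "e > 0"
      with C obtain N where "\<forall>n n'. N \<le> n \<longrightarrow> N \<le> n' \<longrightarrow> hdist V (x n) (x n') < e"
        by (auto simp: MS.MCauchy_def)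
      then show "\<exists>N. \<forall>m\<ge>N. \<forall>n\<ge>N. hnorm V (x m \<ominus> x n) < e" using x by (auto simp: hdist_eq)
    qed
    then show "\<exists>l. limitin MS.mtopology x l sequentially"
      using x by (auto simp: MS.limitin_metric_dist_null hdist_eq)
  qed
qed

end

sublocale hilbert_space \<subseteq> pre_hilbert_space
  by unfold_locales (rule cinner_add cinner_smult cinner_commute cinner_pos; assumption)+

lemma hilbert_spaceI:
  assumes "pre_hilbert_space V" "Metric_space.mcomplete (carrier V) (hdist V)"
  shows "hilbert_space V"
proof -
  interpret pre_hilbert_space V by fact
  show ?thesis
    by unfold_locales (use assms(2) in \<open>auto simp: cinner_add cinner_smult cinner_pos intro: cinner_commute\<close>)
qed

context hilbert_space
begin

lemma Cauchy_limit:
  assumes x: "\<And>n::nat. x n \<in> carrier V"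
    and C: "\<And>e. e > 0 \<Longrightarrow> \<exists>N. \<forall>m\<ge>N. \<forall>n\<ge>N. hnorm V (x m \<ominus> x n) < e"
  obtains l where "l \<in> carrier V" "(\<lambda>n. hnorm V (x n \<ominus> l)) \<longlonglongrightarrow> 0"
proof -
  interpret MS: Metric_space "carrier V" "hdist V" by (rule Metric_space_hdist)
  have "MS.MCauchy x"
    unfolding MS.MCauchy_def
  proof (intro conjI allI impI)
    show "range x \<subseteq> carrier V" using x by auto
    fix e :: real assume "e > 0"
    from C[OF this] obtain N where "\<And>m n. m \<ge> N \<Longrightarrow> n \<ge> N \<Longrightarrow> hnorm V (x m \<ominus> x n) < e" by blast
    then show "\<exists>N. \<forall>n n'. N \<le> n \<longrightarrow> N \<le> n' \<longrightarrow> hdist V (x n) (x n') < e"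
      using x by (auto simp: hdist_eq)
  qed
  then obtain l where "limitin MS.mtopology x l sequentially"
    using complete unfolding MS.mcomplete_def by blast
  then have l: "l \<in> carrier V" and lim: "(\<lambda>n. hdist V (x n) l) \<longlonglongrightarrow> 0"
    by (auto simp: MS.limitin_metric_dist_null)
  have "(\<lambda>n. hnorm V (x n \<ominus> l)) \<longlonglongrightarrow> 0"
    using lim by (simp add: hdist_eq x l)
  with l show thesis by (rule that)
qed

text \<open>The representing vector minimises \<open>x \<mapsto> \<parallel>x\<parallel>\<^sup>2 - 2 Re \<phi> x\<close>; minimising sequences are Cauchy by the
  parallelogram law.\<close>

theorem Riesz_representation:
  assumes add: "\<And>x y. \<lbrakk>x \<in> carrier V; y \<in> carrier V\<rbrakk> \<Longrightarrow> \<phi> (x \<oplus> y) = \<phi> x + \<phi> y"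
    and smult: "\<And>a x. x \<in> carrier V \<Longrightarrow> \<phi> (a \<odot> x) = a * \<phi> x"
    and bd: "\<And>x. x \<in> carrier V \<Longrightarrow> norm (\<phi> x) \<le> c * hnorm V x"
  obtains w where "w \<in> carrier V" "\<And>x. x \<in> carrier V \<Longrightarrow> \<phi> x = cinner V x w"
proof -
  define J where "J x = (hnorm V x)\<^sup>2 - 2 * Re (\<phi> x)" for x
  \<comment> \<open>With t = \<open>hnorm V x\<close>, the bound on \<phi> gives J x >= t^2 - 2 c t
    = (t - c)^2 - c^2.\<close>
  have J_ge: "- c\<^sup>2 \<le> J x" if "x \<in> carrier V" for x
  proof -
    have "Re (\<phi> x) \<le> c * hnorm V x" using bd[OF that] complex_Re_le_cmod order_trans by blast
    moreover have "0 \<le> (hnorm V x - c)\<^sup>2" by simp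
    ultimately show ?thesis unfolding J_def power2_diff by (simp add: mult.commute)
  qed
  define m where "m = (INF x\<in>carrier V. J x)"
  have bdd: "bdd_below (J ` carrier V)" using J_ge by (auto intro!: bdd_belowI)
  have m_le: "m \<le> J x" if "x \<in> carrier V" for x
    unfolding m_def using bdd that by (rule cINF_lower)
  have "\<exists>x\<in>carrier V. J x < m + 1 / real (Suc n)" for n
  proof -
    have "(INF x\<in>carrier V. J x) < m + 1 / real (Suc n)" by (simp add: m_def)
    then show ?thesis by (subst (asm) cINF_less_iff[OF _ bdd]) auto
  qed
  then obtain x where x: "\<And>n. x n \<in> carrier V" and xm: "\<And>n. J (x n) < m + 1 / real (Suc n)"
    by metis
  \<comment> \<open>The real part of \<phi> is additive, so the parallelogram law reads J a + J b -
    2 J((a + b) / 2) = |a - b|^2 / 2, and the midpoint has value at least m.\<close>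
  have par: "(hnorm V (a \<ominus> b))\<^sup>2 \<le> 2 * (J a + J b - 2 * m)" if ab: "a \<in> carrier V" "b \<in> carrier V" for a b
  proof -
    have "m \<le> J ((1/2) \<odot> (a \<oplus> b))" using ab by (intro m_le) auto
    also have "\<dots> = (hnorm V (a \<oplus> b))\<^sup>2 / 4 - Re (\<phi> a) - Re (\<phi> b)"
      using ab by (simp add: J_def smult add hnorm_smult power_mult_distrib power2_eq_square add_divide_distrib)
    finally have "m \<le> \<dots>" .
    then show ?thesis using ab by (simp add: J_def hnorm_diff_sq hnorm_add_sq field_simps)
  qed
  obtain w where w: "w \<in> carrier V" and lim: "(\<lambda>n. hnorm V (x n \<ominus> w)) \<longlonglongrightarrow> 0"
  proof (rule Cauchy_limit[OF x])
    fix e :: real assume e: "e > 0"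
    \<comment> \<open>By \<open>par\<close>, the squared distance of two members with indices at
      least N is below 2 (2 / (N + 1)) = 4 / (N + 1).\<close>
    obtain N where N: "4 / e\<^sup>2 < real (Suc N)"
      using reals_Archimedean2[of "4 / e\<^sup>2"] by (metis less_Suc_eq order_less_trans of_nat_less_iff)
    have "hnorm V (x k \<ominus> x l) < e" if kl: "k \<ge> N" "l \<ge> N" for k l
    proof (rule power2_less_imp_less)
      have "(hnorm V (x k \<ominus> x l))\<^sup>2 \<le> 2 * (J (x k) + J (x l) - 2 * m)" by (rule par[OF x x])
      also have "\<dots> < 2 * (1 / real (Suc k) + 1 / real (Suc l))" using xm[of k] xm[of l] by simp
      also have "\<dots> \<le> 2 * (1 / real (Suc N) + 1 / real (Suc N))"
        using kl by (intro mult_left_mono add_mono divide_left_mono) auto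
      also have "\<dots> < e\<^sup>2" using N e by (simp add: field_simps)
      finally show "(hnorm V (x k \<ominus> x l))\<^sup>2 < e\<^sup>2" .
    qed (use e in auto)
    then show "\<exists>N. \<forall>m\<ge>N. \<forall>n\<ge>N. hnorm V (x m \<ominus> x n) < e" by blast
  qed
  have "(\<lambda>n. Re (\<phi> (x n))) \<longlonglongrightarrow> Re (\<phi> w)"
  proof (rule tendsto_Re, rule Lim_transform[OF tendsto_const])
    have "(\<lambda>n. c * hnorm V (x n \<ominus> w)) \<longlonglongrightarrow> 0"
      using tendsto_mult_left[OF lim, of c] by simp
    moreover have "\<phi> (x n) - \<phi> w = \<phi> (x n \<ominus> w)" for n
    proof -
      have "x n = (x n \<ominus> w) \<oplus> w"
        by (rule vec_eqI) (use x w in \<open>auto simp: cinner_simps\<close>)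
      then have "\<phi> (x n) = \<phi> (x n \<ominus> w) + \<phi> w" using add x w by (metis minus_in)
      then show ?thesis by simp
    qed
    ultimately show "(\<lambda>n. \<phi> (x n) - \<phi> w) \<longlonglongrightarrow> 0"
      by (elim Lim_null_comparison[rotated]) (use bd x w in \<open>auto intro!: always_eventually\<close>)
  qed
  then have "(\<lambda>n. J (x n)) \<longlonglongrightarrow> J w"
    unfolding J_def using tendsto_hnorm[OF x w lim]
    by (intro tendsto_diff tendsto_power tendsto_mult_left)
  moreover have "(\<lambda>n. m + 1 / real (Suc n)) \<longlonglongrightarrow> m + 0"
    using LIMSEQ_inverse_real_of_nat by (intro tendsto_intros) (simp add: inverse_eq_divide)
  ultimately have Jw: "J w \<le> m"
    using xm by (intro LIMSEQ_le[of "\<lambda>n. J (x n)" _ "\<lambda>n. m + 1 / real (Suc n)"]) (auto intro: less_imp_le)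
  have Re_eq: "Re (\<phi> y) = Re (cinner V y w)" if y: "y \<in> carrier V" for y
  proof -
    define d where "d = Re (cinner V y w) - Re (\<phi> y)"
    \<comment> \<open>The right-hand side is J (w + t y) - J w, which is nonnegative because w is a
      minimiser.\<close>
    have q: "0 \<le> 2 * t * d + t\<^sup>2 * (hnorm V y)\<^sup>2" for t :: real
    proof -
      have "J w \<le> J (w \<oplus> complex_of_real t \<odot> y)" using Jw m_le[of "w \<oplus> complex_of_real t \<odot> y"] w y by auto
      then show ?thesis
        using w y cinner_commute[OF w y]
        by (simp add: J_def add smult hnorm_add_sq hnorm_smult cinner_simps d_def power_mult_distrib algebra_simps)
    qed
    have "d = 0"
    proof (rule ccontr)
      assume d: "d \<noteq> 0"
      \<comment> \<open>The summand 1 keeps D positive even for y = 0. The choice s = - d / D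
        minimises 2 s d + s^2 D, with the negative value - d^2 / D.\<close>
      define D where "D = (hnorm V y)\<^sup>2 + 1"
      have D: "D > 0" using zero_le_power2[of "hnorm V y"] unfolding D_def by linarith
      define s where "s = - d / D"
      have "2 * s * d + s\<^sup>2 * (hnorm V y)\<^sup>2 \<le> 2 * s * d + s\<^sup>2 * D"
        by (simp add: D_def mult_left_mono)
      also have "\<dots> = - d\<^sup>2 / D"
        using D by (simp add: s_def field_simps power2_eq_square)
      also have "\<dots> < 0" using d D by (simp add: divide_neg_pos)
      finally show False using q[of s] by simp
    qed
    then show ?thesis by (simp add: d_def)
  qed
  \<comment> \<open>Imaginary parts follow from real parts at \<i> y, since Re (\<i> a) = - Im a for
    every complex a.\<close>
  have "\<phi> y = cinner V y w" if y: "y \<in> carrier V" for y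
    using Re_eq[OF y] Re_eq[of "\<i> \<odot> y"] y w by (simp add: smult cinner_simps complex_eq_iff)
  with w show thesis by (rule that)
qed

end

section \<open>Summability of unordered families\<close>

lemma summable_on_mult_of_squares:
  fixes p q :: "'i \<Rightarrow> real"
  assumes "(\<lambda>i. (p i)\<^sup>2) summable_on A" "(\<lambda>i. (q i)\<^sup>2) summable_on A"
  shows "(\<lambda>i. p i * q i) summable_on A"
  using abs_summable_summable[OF abs_summable_product[of p A q]] assms
  by (simp add: power2_eq_square)

lemma summable_on_norm_bound:
  fixes f :: "'i \<Rightarrow> complex"
  assumes "g summable_on A" "\<And>i. i \<in> A \<Longrightarrow> norm (f i) \<le> g i"
  shows "(\<lambda>i. norm (f i)) summable_on A"
  using assms by (intro summable_on_comparison_test[OF assms(1)]) auto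

lemma infsum_complex_of_real:
  assumes "f summable_on A"
  shows "(\<Sum>\<^sub>\<infinity>x\<in>A. complex_of_real (f x)) = complex_of_real (infsum f A)"
  by (rule infsumI) (use assms in \<open>simp add: has_sum_of_real_iff\<close>)

lemma bdd_sums_summable:
  fixes f :: "'i \<Rightarrow> real"
  assumes "\<And>x. x \<in> A \<Longrightarrow> 0 \<le> f x" "\<And>F. finite F \<Longrightarrow> F \<subseteq> A \<Longrightarrow> sum f F \<le> b"
  shows "f summable_on A" "infsum f A \<le> b"
proof -
  show s: "f summable_on A"
    using assms by (intro nonneg_bdd_above_summable_on) (auto intro!: bdd_aboveI2)
  show "infsum f A \<le> b" by (rule infsum_le_finite_sums[OF s assms(2)])
qed

section \<open>Orthonormal bases\<close>

text \<open>The totality clause of \<open>orthonormal_basis\<close> is left out: Zorn's lemma and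
  Bessel's inequality deal with systems, in particular finite ones, that need not be total.\<close>

definition orthonormal :: "'a hilb \<Rightarrow> 'a set \<Rightarrow> bool" where
  "orthonormal V B \<longleftrightarrow> B \<subseteq> carrier V \<and>
     (\<forall>b\<in>B. \<forall>c\<in>B. cinner V b c = (if b = c then 1 else 0))"

context hilbert_space
begin

lemma orthonormal_subset: "orthonormal V B \<Longrightarrow> C \<subseteq> B \<Longrightarrow> orthonormal V C"
  unfolding orthonormal_def by blast

text \<open>A maximal orthonormal set is total, because a nonzero vector orthogonal to it could be
  normalised and adjoined. This makes the choice in \<open>some_basis\<close> a genuine
  basis.\<close>

lemma basis_exists: "\<exists>B. orthonormal_basis V B"
proof -
  have "\<exists>M\<in>Collect (orthonormal V). \<forall>X\<in>Collect (orthonormal V). M \<subseteq> X \<longrightarrow> X = M"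
  proof (rule subset_Zorn')
    fix C assume C: "subset.chain (Collect (orthonormal V)) C"
    then have on: "\<And>B. B \<in> C \<Longrightarrow> orthonormal V B" and tot: "\<And>A B. \<lbrakk>A \<in> C; B \<in> C\<rbrakk> \<Longrightarrow> A \<subseteq> B \<or> B \<subseteq> A"
      by (auto simp: subset_chain_def)
    have "cinner V b c = (if b = c then 1 else 0)" if "b \<in> \<Union>C" "c \<in> \<Union>C" for b c
    proof -
      obtain D1 D2 where "D1 \<in> C" "b \<in> D1" "D2 \<in> C" "c \<in> D2" using \<open>b \<in> \<Union>C\<close> \<open>c \<in> \<Union>C\<close> by blast
      then obtain D where "D \<in> C" "b \<in> D" "c \<in> D" using tot[of D1 D2] by blast
      then show ?thesis using on unfolding orthonormal_def by blast
    qed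
    moreover have "\<Union>C \<subseteq> carrier V" using on by (auto simp: orthonormal_def)
    ultimately show "\<Union>C \<in> Collect (orthonormal V)" by (auto simp: orthonormal_def)
  qed
  then obtain M where M: "orthonormal V M" and max: "\<And>X. orthonormal V X \<Longrightarrow> M \<subseteq> X \<Longrightarrow> X = M"
    by auto
  have "x = \<zero>" if x: "x \<in> carrier V" and perp: "\<forall>b\<in>M. cinner V x b = 0" for x
  proof (rule ccontr)
    assume nz: "x \<noteq> \<zero>"
    define e where "e = complex_of_real (1 / hnorm V x) \<odot> x"
    have e: "e \<in> carrier V" using x by (simp add: e_def)
    have hx: "hnorm V x \<noteq> 0" using nz x by (simp add: hnorm_eq_0)
    have "hnorm V e = 1" using hx x by (simp add: e_def hnorm_smult norm_divide)
    then have ee: "cinner V e e = 1" using e by (simp add: cinner_self)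
    have eM: "cinner V e b = 0" "cinner V b e = 0" if "b \<in> M" for b
    proof -
      have b: "b \<in> carrier V" using that M by (auto simp: orthonormal_def)
      show "cinner V e b = 0" using that perp x b by (simp add: e_def cinner_smult)
      then show "cinner V b e = 0" using cinner_commute[OF e b] by simp
    qed
    have "orthonormal V (insert e M)"
      using M e ee eM by (auto simp: orthonormal_def)
    then have "e \<in> M" using max by blast
    then show False using eM ee by force
  qed
  then show ?thesis using M unfolding orthonormal_basis_def orthonormal_def by blast
qed

lemma some_basis: "orthonormal_basis V (some_basis V)"
  unfolding some_basis_def using basis_exists by (rule someI_ex)

lemma orthonormal_some_basis: "orthonormal V (some_basis V)"
  using some_basis by (simp add: orthonormal_basis_def orthonormal_def)

lemma some_basis_in [simp]: "b \<in> some_basis V \<Longrightarrow> b \<in> carrier V"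
  using some_basis by (auto simp: orthonormal_basis_def)

lemma some_basis_total: "\<lbrakk>x \<in> carrier V; \<And>b. b \<in> some_basis V \<Longrightarrow> cinner V x b = 0\<rbrakk> \<Longrightarrow> x = \<zero>"
  using some_basis by (auto simp: orthonormal_basis_def)

text \<open>Subtracting from x its component along one basis vector b leaves the coefficients along
  the other vectors unchanged and lowers the squared norm by exactly |<x, b>|^2.\<close>

lemma Bessel_finite:
  assumes "finite F" "orthonormal V F" "x \<in> carrier V"
  shows "(\<Sum>b\<in>F. (norm (cinner V x b))\<^sup>2) \<le> (hnorm V x)\<^sup>2"
  using assms
proof (induction F arbitrary: x rule: finite_induct)
  case empty
  then show ?case by simp
next
  case (insert b F)
  have b: "b \<in> carrier V" and F: "F \<subseteq> carrier V" and bb: "cinner V b b = 1"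
    and bF: "\<And>c. c \<in> F \<Longrightarrow> cinner V b c = 0"
    using insert by (auto simp: orthonormal_def)
  define a where "a = cinner V x b"
  define y where "y = x \<ominus> a \<odot> b"
  have y: "y \<in> carrier V" using b insert.prems by (simp add: y_def)
  have "(\<Sum>c\<in>F. (norm (cinner V x c))\<^sup>2) = (\<Sum>c\<in>F. (norm (cinner V y c))\<^sup>2)"
    using F b bF insert.prems by (intro sum.cong) (auto simp: y_def cinner_simps subset_iff)
  also have "\<dots> \<le> (hnorm V y)\<^sup>2"
    using insert.prems y by (intro insert.IH) (auto simp: orthonormal_def)
  also have "\<dots> = (hnorm V x)\<^sup>2 - (norm a)\<^sup>2"
  proof -
    have "hnorm V b = 1" using bb by (simp add: hnorm_def)
    moreover have "cnj a * a = of_real ((norm a)\<^sup>2)"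
      using complex_norm_square[of a] by (simp add: mult.commute)
    ultimately show ?thesis
      using b insert.prems unfolding y_def
      by (simp add: hnorm_diff_sq hnorm_smult cinner_simps a_def[symmetric])
  qed
  finally show ?case using insert.hyps by (simp add: a_def)
qed

lemma Bessel:
  assumes "orthonormal V B" "x \<in> carrier V"
  shows "(\<lambda>b. (norm (cinner V x b))\<^sup>2) summable_on B"
    "(\<Sum>\<^sub>\<infinity>b\<in>B. (norm (cinner V x b))\<^sup>2) \<le> (hnorm V x)\<^sup>2"
proof -
  have "(\<Sum>b\<in>F. (norm (cinner V x b))\<^sup>2) \<le> (hnorm V x)\<^sup>2" if "finite F" "F \<subseteq> B" for F
    using that assms Bessel_finite orthonormal_subset by blast
  from bdd_sums_summable[OF _ this]
  show "(\<lambda>b. (norm (cinner V x b))\<^sup>2) summable_on B"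
    "(\<Sum>\<^sub>\<infinity>b\<in>B. (norm (cinner V x b))\<^sup>2) \<le> (hnorm V x)\<^sup>2"
    by auto
qed

text \<open>Riesz representation of \<open>x \<mapsto> \<Sum>b. \<langle>x, b\<rangle> \<langle>b, w\<rangle>\<close> yields a vector with the same coefficients as
  \<open>w\<close>, hence \<open>w\<close> itself.\<close>

lemma Parseval:
  assumes w: "w \<in> carrier V"
  shows "(\<Sum>\<^sub>\<infinity>b\<in>some_basis V. (norm (cinner V w b))\<^sup>2) = (hnorm V w)\<^sup>2"
proof -
  let ?B = "some_basis V"
  define q where "q x = (\<Sum>\<^sub>\<infinity>b\<in>?B. cinner V x b * cnj (cinner V w b))" for x
  note bes = Bessel[OF orthonormal_some_basis]
  have abs: "(\<lambda>b. norm (cinner V x b * cnj (cinner V w b))) summable_on ?B" if "x \<in> carrier V" for x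
    using summable_on_mult_of_squares[OF bes(1)[OF that] bes(1)[OF w]] by (simp add: norm_mult)
  note sm = abs_summable_summable[OF abs]
  obtain w' where w': "w' \<in> carrier V" and rep: "\<And>x. x \<in> carrier V \<Longrightarrow> q x = cinner V x w'"
  proof (rule Riesz_representation[of q "hnorm V w"])
    fix x y assume xy: "x \<in> carrier V" "y \<in> carrier V"
    have "q (x \<oplus> y) = (\<Sum>\<^sub>\<infinity>b\<in>?B. cinner V x b * cnj (cinner V w b) + cinner V y b * cnj (cinner V w b))"
      unfolding q_def by (intro infsum_cong) (use xy in \<open>auto simp: cinner_simps distrib_right\<close>)
    also have "\<dots> = q x + q y" unfolding q_def by (intro infsum_add sm xy)
    finally show "q (x \<oplus> y) = q x + q y" .
  next
    fix a x assume x: "x \<in> carrier V"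
    have "q (a \<odot> x) = (\<Sum>\<^sub>\<infinity>b\<in>?B. a * (cinner V x b * cnj (cinner V w b)))"
      unfolding q_def by (intro infsum_cong) (use x in \<open>auto simp: cinner_simps\<close>)
    also have "\<dots> = a * q x" unfolding q_def by (rule infsum_cmult_right')
    finally show "q (a \<odot> x) = a * q x" .
  next
    fix x assume x: "x \<in> carrier V"
    have "norm (q x) \<le> (\<Sum>\<^sub>\<infinity>b\<in>?B. norm (cinner V x b * cnj (cinner V w b)))"
      unfolding q_def by (rule norm_infsum_bound[OF abs[OF x]])
    also have "\<dots> \<le> hnorm V w * hnorm V x"
    proof (rule infsum_le_finite_sums[OF abs[OF x]])
      fix F assume F: "finite F" "F \<subseteq> ?B"
      show "(\<Sum>b\<in>F. norm (cinner V x b * cnj (cinner V w b))) \<le> hnorm V w * hnorm V x"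
      proof (rule power2_le_imp_le)
        have on: "orthonormal V F" using orthonormal_subset[OF orthonormal_some_basis F(2)] .
        \<comment> \<open>Cauchy-Schwarz for finite sums followed by Bessel on each factor bounds
          every partial sum by a constant independent of F.\<close>
        have "(\<Sum>b\<in>F. norm (cinner V x b * cnj (cinner V w b)))\<^sup>2
           \<le> (\<Sum>b\<in>F. (norm (cinner V x b))\<^sup>2) * (\<Sum>b\<in>F. (norm (cinner V w b))\<^sup>2)"
          using Cauchy_Schwarz_ineq_sum[of "\<lambda>b. norm (cinner V x b)" "\<lambda>b. norm (cinner V w b)" F]
          by (simp add: norm_mult)
        also have "\<dots> \<le> (hnorm V x)\<^sup>2 * (hnorm V w)\<^sup>2"
          by (intro mult_mono Bessel_finite F on x w sum_nonneg) auto
        finally show "(\<Sum>b\<in>F. norm (cinner V x b * cnj (cinner V w b)))\<^sup>2 \<le> (hnorm V w * hnorm V x)\<^sup>2"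
          by (simp add: power_mult_distrib mult.commute)
      qed (use w x in simp)
    qed
    finally show "norm (q x) \<le> hnorm V w * hnorm V x" .
  qed (rule that)
  have "w' \<ominus> w = \<zero>"
  proof (rule some_basis_total)
    fix b assume b: "b \<in> ?B"
    \<comment> \<open>At a basis vector the series defining q collapses to the term c = b, so w' and
      w have the same coefficients.\<close>
    have "q b = (\<Sum>\<^sub>\<infinity>c\<in>{b}. cinner V b c * cnj (cinner V w c))"
      unfolding q_def using b some_basis
      by (intro infsum_cong_neutral) (auto simp: orthonormal_basis_def)
    also have "\<dots> = cnj (cinner V w b)"
      using b some_basis by (simp add: orthonormal_basis_def)
    finally have "cinner V b w' = cnj (cinner V w b)" using rep b by simp
    then have "cinner V w' b = cinner V w b"
      using cinner_commute[OF _ w', of b] b by simp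
    then show "cinner V (w' \<ominus> w) b = 0" using b w w' by (simp add: cinner_simps)
  qed (use w w' in simp)
  then have "w' = w" using w w' diff_eq_zero by blast
  \<comment> \<open>Parseval comes from evaluating q w twice: as <w, w> through the representing
    vector, and as the series of squared coefficients by definition.\<close>
  then have "q w = of_real ((hnorm V w)\<^sup>2)" using rep[OF w] w by (simp add: cinner_self)
  moreover have "q w = of_real (\<Sum>\<^sub>\<infinity>b\<in>?B. (norm (cinner V w b))\<^sup>2)"
    unfolding q_def using infsum_complex_of_real[OF bes(1)[OF w]]
    by (simp only: complex_norm_square[symmetric])
  ultimately show ?thesis by (simp only: of_real_eq_iff)
qed

end

section \<open>Bounded operators\<close>

lemma bounded_ops_simps:
  "T \<in> carrier (bounded_ops V) \<longleftrightarrow> T \<in> carrier V \<rightarrow>\<^sub>E carrier V \<and>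
        (\<forall>x\<in>carrier V. \<forall>y\<in>carrier V. T (x \<oplus>\<^bsub>V\<^esub> y) = T x \<oplus>\<^bsub>V\<^esub> T y) \<and>
        (\<forall>a. \<forall>x\<in>carrier V. T (a \<odot>\<^bsub>V\<^esub> x) = a \<odot>\<^bsub>V\<^esub> T x) \<and>
        (\<exists>c. \<forall>x\<in>carrier V. hnorm V (T x) \<le> c * hnorm V x)"
  "S \<otimes>\<^bsub>bounded_ops V\<^esub> T = compose (carrier V) S T"
  "\<one>\<^bsub>bounded_ops V\<^esub> = (\<lambda>x\<in>carrier V. x)"
  "\<zero>\<^bsub>bounded_ops V\<^esub> = (\<lambda>x\<in>carrier V. \<zero>\<^bsub>V\<^esub>)"
  "S \<oplus>\<^bsub>bounded_ops V\<^esub> T = (\<lambda>x\<in>carrier V. S x \<oplus>\<^bsub>V\<^esub> T x)"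
  "a \<odot>\<^bsub>bounded_ops V\<^esub> T = (\<lambda>x\<in>carrier V. a \<odot>\<^bsub>V\<^esub> T x)"
  by (simp_all add: bounded_ops_def)

context hilbert_space
begin

lemma op_in [simp]: "\<lbrakk>T \<in> carrier (bounded_ops V); x \<in> carrier V\<rbrakk> \<Longrightarrow> T x \<in> carrier V"
  by (auto simp: bounded_ops_simps)

lemma op_add: "\<lbrakk>T \<in> carrier (bounded_ops V); x \<in> carrier V; y \<in> carrier V\<rbrakk> \<Longrightarrow> T (x \<oplus> y) = T x \<oplus> T y"
  by (auto simp: bounded_ops_simps)

lemma op_smult: "\<lbrakk>T \<in> carrier (bounded_ops V); x \<in> carrier V\<rbrakk> \<Longrightarrow> T (a \<odot> x) = a \<odot> T x"
  by (auto simp: bounded_ops_simps)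

lemma op_bound:
  assumes "T \<in> carrier (bounded_ops V)"
  obtains c where "c \<ge> 0" "\<And>x. x \<in> carrier V \<Longrightarrow> hnorm V (T x) \<le> c * hnorm V x"
proof -
  obtain c where c: "\<And>x. x \<in> carrier V \<Longrightarrow> hnorm V (T x) \<le> c * hnorm V x"
    using assms unfolding bounded_ops_simps by metis
  have "hnorm V (T x) \<le> \<bar>c\<bar> * hnorm V x" if "x \<in> carrier V" for x
    using c[OF that] abs_ge_self mult_right_mono hnorm_nonneg[OF that] order_trans by meson
  then show thesis using that[of "\<bar>c\<bar>"] by simp
qed

lemma op_eqI:
  assumes "S \<in> carrier (bounded_ops V)" "T \<in> carrier (bounded_ops V)"
    "\<And>x y. \<lbrakk>x \<in> carrier V; y \<in> carrier V\<rbrakk> \<Longrightarrow> cinner V (S x) y = cinner V (T x) y"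
  shows "S = T"
proof (rule PiE_ext)
  show "S \<in> carrier V \<rightarrow>\<^sub>E carrier V" "T \<in> carrier V \<rightarrow>\<^sub>E carrier V"
    using assms(1,2) by (simp_all add: bounded_ops_simps)
  show "S x = T x" if "x \<in> carrier V" for x
    using that assms by (intro vec_eqI) auto
qed

text \<open>Linearity is demanded only after pairing with an arbitrary z, so that for the
  constructions below it can be checked by \<open>cinner_simps\<close>.\<close>

lemma op_inI:
  assumes "\<And>x. x \<in> carrier V \<Longrightarrow> T x \<in> carrier V" "\<And>x. x \<notin> carrier V \<Longrightarrow> T x = undefined"
    and "\<And>x y z. \<lbrakk>x \<in> carrier V; y \<in> carrier V; z \<in> carrier V\<rbrakk> \<Longrightarrow>
      cinner V (T (x \<oplus> y)) z = cinner V (T x) z + cinner V (T y) z"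
    and "\<And>a x z. \<lbrakk>x \<in> carrier V; z \<in> carrier V\<rbrakk> \<Longrightarrow> cinner V (T (a \<odot> x)) z = a * cinner V (T x) z"
    and "\<And>x. x \<in> carrier V \<Longrightarrow> hnorm V (T x) \<le> c * hnorm V x"
  shows "T \<in> carrier (bounded_ops V)"
  unfolding bounded_ops_simps
proof (intro conjI ballI allI)
  show "T \<in> carrier V \<rightarrow>\<^sub>E carrier V" using assms by auto
  show "T (x \<oplus> y) = T x \<oplus> T y" if "x \<in> carrier V" "y \<in> carrier V" for x y
    by (rule vec_eqI) (use assms that in \<open>auto simp: cinner_simps\<close>)
  show "T (a \<odot> x) = a \<odot> T x" if "x \<in> carrier V" for a x
    by (rule vec_eqI) (use assms that in \<open>auto simp: cinner_simps\<close>)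
  show "\<exists>c. \<forall>x\<in>carrier V. hnorm V (T x) \<le> c * hnorm V x" using assms(5) by blast
qed

lemma smult_op_in [simp, intro]:
  assumes T: "T \<in> carrier (bounded_ops V)"
  shows "a \<odot>\<^bsub>bounded_ops V\<^esub> T \<in> carrier (bounded_ops V)"
proof -
  obtain c where c: "\<And>x. x \<in> carrier V \<Longrightarrow> hnorm V (T x) \<le> c * hnorm V x"
    using op_bound[OF T] by blast
  show ?thesis
  proof (rule op_inI[where c = "norm a * c"])
    show "hnorm V ((a \<odot>\<^bsub>bounded_ops V\<^esub> T) x) \<le> norm a * c * hnorm V x" if "x \<in> carrier V" for x
      using that T c[OF that] by (simp add: bounded_ops_simps(6) hnorm_smult mult.assoc mult_left_mono)
  qed (use T in \<open>auto simp: bounded_ops_simps(6) op_add op_smult cinner_simps distrib_left\<close>)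
qed

lemma smult_op_apply: "x \<in> carrier V \<Longrightarrow> (a \<odot>\<^bsub>bounded_ops V\<^esub> T) x = a \<odot> T x"
  by (simp add: bounded_ops_simps(6))

lemma cinner_smult_op:
  "\<lbrakk>T \<in> carrier (bounded_ops V); x \<in> carrier V; y \<in> carrier V\<rbrakk> \<Longrightarrow>
     cinner V ((a \<odot>\<^bsub>bounded_ops V\<^esub> T) x) y = a * cinner V (T x) y"
  by (simp add: bounded_ops_simps(6) cinner_simps)

lemma add_op_in:
  assumes S: "S \<in> carrier (bounded_ops V)" and T: "T \<in> carrier (bounded_ops V)"
  shows "S \<oplus>\<^bsub>bounded_ops V\<^esub> T \<in> carrier (bounded_ops V)"
proof -
  obtain c where c: "\<And>x. x \<in> carrier V \<Longrightarrow> hnorm V (T x) \<le> c * hnorm V x"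
    using op_bound[OF T] by blast
  obtain d where d: "\<And>x. x \<in> carrier V \<Longrightarrow> hnorm V (S x) \<le> d * hnorm V x"
    using op_bound[OF S] by blast
  show ?thesis
  proof (rule op_inI[where c = "d + c"])
    show "hnorm V ((S \<oplus>\<^bsub>bounded_ops V\<^esub> T) x) \<le> (d + c) * hnorm V x" if "x \<in> carrier V" for x
      using that T S c[OF that] d[OF that] hnorm_triangle[of "S x" "T x"]
      by (simp add: bounded_ops_simps(5) distrib_right)
  qed (use T S in \<open>auto simp: bounded_ops_simps(5) op_add op_smult cinner_simps distrib_left\<close>)
qed

lemma cinner_add_op:
  "\<lbrakk>S \<in> carrier (bounded_ops V); T \<in> carrier (bounded_ops V); x \<in> carrier V; y \<in> carrier V\<rbrakk> \<Longrightarrow>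
     cinner V ((S \<oplus>\<^bsub>bounded_ops V\<^esub> T) x) y = cinner V (S x) y + cinner V (T x) y"
  by (simp add: bounded_ops_simps(5) cinner_simps)

lemma zero_op_in: "\<zero>\<^bsub>bounded_ops V\<^esub> \<in> carrier (bounded_ops V)"
  by (rule op_inI[where c = 0]) (auto simp: bounded_ops_simps(4))

lemma cinner_zero_op: "\<lbrakk>x \<in> carrier V; y \<in> carrier V\<rbrakk> \<Longrightarrow> cinner V (\<zero>\<^bsub>bounded_ops V\<^esub> x) y = 0"
  by (simp add: bounded_ops_simps(4))

text \<open>Differences and finite sums of operators are derived notions of the additive group;
  their quadratic forms can be computed only once the group laws are available.\<close>

lemma abelian_group_ops: "abelian_group (bounded_ops V)"
proof (rule abelian_groupI)
  fix S T U
  assume S: "S \<in> carrier (bounded_ops V)"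
  show "\<exists>T\<in>carrier (bounded_ops V). T \<oplus>\<^bsub>bounded_ops V\<^esub> S = \<zero>\<^bsub>bounded_ops V\<^esub>"
    using S by (intro bexI[of _ "(-1) \<odot>\<^bsub>bounded_ops V\<^esub> S"] op_eqI)
      (auto simp: cinner_add_op cinner_zero_op cinner_smult_op add_op_in zero_op_in)
  show "\<zero>\<^bsub>bounded_ops V\<^esub> \<oplus>\<^bsub>bounded_ops V\<^esub> S = S"
    using S by (intro op_eqI) (auto simp: cinner_add_op cinner_zero_op add_op_in zero_op_in)
  assume T: "T \<in> carrier (bounded_ops V)"
  show "S \<oplus>\<^bsub>bounded_ops V\<^esub> T = T \<oplus>\<^bsub>bounded_ops V\<^esub> S"
    using S T by (intro op_eqI) (auto simp: cinner_add_op add_op_in)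
  assume U: "U \<in> carrier (bounded_ops V)"
  show "S \<oplus>\<^bsub>bounded_ops V\<^esub> T \<oplus>\<^bsub>bounded_ops V\<^esub> U = S \<oplus>\<^bsub>bounded_ops V\<^esub> (T \<oplus>\<^bsub>bounded_ops V\<^esub> U)"
    using S T U by (intro op_eqI) (auto simp: cinner_add_op add_op_in)
qed (auto intro: add_op_in zero_op_in)

sublocale ops: abelian_group "bounded_ops V"
  by (rule abelian_group_ops)

lemma cinner_diff_op:
  assumes "S \<in> carrier (bounded_ops V)" "T \<in> carrier (bounded_ops V)" "x \<in> carrier V" "y \<in> carrier V"
  shows "cinner V ((S \<ominus>\<^bsub>bounded_ops V\<^esub> T) x) y = cinner V (S x) y - cinner V (T x) y"
proof -
  have "(S \<ominus>\<^bsub>bounded_ops V\<^esub> T) \<oplus>\<^bsub>bounded_ops V\<^esub> T = S"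
    using assms by (simp add: ops.minus_eq ops.a_assoc ops.l_neg)
  then have "cinner V (S x) y = cinner V ((S \<ominus>\<^bsub>bounded_ops V\<^esub> T) x) y + cinner V (T x) y"
    using assms cinner_add_op[of "S \<ominus>\<^bsub>bounded_ops V\<^esub> T" T x y] by simp
  then show ?thesis by simp
qed

lemma cinner_finsum_op:
  assumes "finite A" "g \<in> A \<rightarrow> carrier (bounded_ops V)" "x \<in> carrier V" "y \<in> carrier V"
  shows "cinner V ((\<Oplus>\<^bsub>bounded_ops V\<^esub>i\<in>A. g i) x) y = (\<Sum>i\<in>A. cinner V (g i x) y)"
  using assms
  by (induction A rule: finite_induct)
    (auto simp: cinner_zero_op cinner_add_op Pi_iff)

lemma mult_op_in [simp, intro]:
  assumes S: "S \<in> carrier (bounded_ops V)" and T: "T \<in> carrier (bounded_ops V)"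
  shows "S \<otimes>\<^bsub>bounded_ops V\<^esub> T \<in> carrier (bounded_ops V)"
proof -
  obtain c where c: "\<And>x. x \<in> carrier V \<Longrightarrow> hnorm V (T x) \<le> c * hnorm V x"
    using op_bound[OF T] by blast
  obtain d where d0: "d \<ge> 0" and d: "\<And>x. x \<in> carrier V \<Longrightarrow> hnorm V (S x) \<le> d * hnorm V x"
    using op_bound[OF S] by blast
  show ?thesis
  proof (rule op_inI[where c = "d * c"])
    fix x assume x: "x \<in> carrier V"
    have "hnorm V (S (T x)) \<le> d * hnorm V (T x)" using d T x by simp
    also have "\<dots> \<le> d * (c * hnorm V x)" using c[OF x] d0 by (rule mult_left_mono)
    finally show "hnorm V ((S \<otimes>\<^bsub>bounded_ops V\<^esub> T) x) \<le> d * c * hnorm V x"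
      using x by (simp add: bounded_ops_simps(2) compose_def mult.assoc)
  qed (use T S in \<open>auto simp: bounded_ops_simps(2) compose_def op_add op_smult cinner_simps distrib_left\<close>)
qed

lemma mult_op_apply [simp]: "x \<in> carrier V \<Longrightarrow> (S \<otimes>\<^bsub>bounded_ops V\<^esub> T) x = S (T x)"
  by (simp add: bounded_ops_simps(2) compose_def)

lemma one_op_in [simp, intro]: "\<one>\<^bsub>bounded_ops V\<^esub> \<in> carrier (bounded_ops V)"
  by (rule op_inI[where c = 1]) (auto simp: bounded_ops_simps(3) cinner_simps)

text \<open>\<open>opnorm\<close> is a supremum of reals, which dominates the individual values only
  if they are bounded above.\<close>

lemma bdd_above_opnorm:
  assumes T: "T \<in> carrier (bounded_ops V)"
  shows "bdd_above ((\<lambda>x. hnorm V (T x)) ` {x \<in> carrier V. hnorm V x \<le> 1})"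
proof -
  obtain c where c0: "c \<ge> 0" and c: "\<And>x. x \<in> carrier V \<Longrightarrow> hnorm V (T x) \<le> c * hnorm V x"
    using op_bound[OF T] by blast
  show ?thesis
  proof (rule bdd_aboveI2)
    fix x assume "x \<in> {x \<in> carrier V. hnorm V x \<le> 1}"
    then show "hnorm V (T x) \<le> c"
      using c[of x] c0 by (auto intro: order_trans mult_left_le)
  qed
qed

lemma hnorm_le_opnorm:
  assumes T: "T \<in> carrier (bounded_ops V)" and x: "x \<in> carrier V"
  shows "hnorm V (T x) \<le> opnorm V T * hnorm V x"
proof (cases "x = \<zero>")
  case True
  obtain c where "hnorm V (T \<zero>) \<le> c * hnorm V \<zero>"
    using op_bound[OF T] M.zero_closed by blast
  then show ?thesis using True by simp
next
  case False
  then have h: "hnorm V x > 0" using x hnorm_eq_0[OF x] hnorm_nonneg[OF x] by linarith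
  define y where "y = complex_of_real (1 / hnorm V x) \<odot> x"
  have y: "y \<in> carrier V" "hnorm V y \<le> 1" using x h by (auto simp: y_def hnorm_smult norm_divide)
  have "hnorm V (T y) \<le> opnorm V T"
    unfolding opnorm_def using y by (intro cSUP_upper bdd_above_opnorm T) auto
  moreover have "hnorm V (T y) = hnorm V (T x) / hnorm V x"
    using x h T by (simp add: y_def op_smult hnorm_smult norm_divide)
  ultimately show ?thesis using h by (simp add: field_simps)
qed

lemma opnorm_leI:
  assumes "\<And>x. x \<in> carrier V \<Longrightarrow> hnorm V (T x) \<le> c * hnorm V x" "c \<ge> 0"
  shows "opnorm V T \<le> c"
  unfolding opnorm_def
proof (rule cSUP_least)
  show "{x \<in> carrier V. hnorm V x \<le> 1} \<noteq> {}" using hnorm_zero by force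
  fix x assume "x \<in> {x \<in> carrier V. hnorm V x \<le> 1}"
  then show "hnorm V (T x) \<le> c" using assms(1)[of x] assms(2) by (auto intro: order_trans mult_left_le)
qed

lemma opnorm_nonneg:
  assumes T: "T \<in> carrier (bounded_ops V)"
  shows "0 \<le> opnorm V T"
proof -
  have "hnorm V (T \<zero>) \<le> opnorm V T"
    unfolding opnorm_def by (rule cSUP_upper[OF _ bdd_above_opnorm[OF T]]) auto
  then show ?thesis using T by (meson hnorm_nonneg M.zero_closed op_in order_trans)
qed

lemma opnorm_smult_le:
  assumes "T \<in> carrier (bounded_ops V)"
  shows "opnorm V (a \<odot>\<^bsub>bounded_ops V\<^esub> T) \<le> norm a * opnorm V T"
proof (rule opnorm_leI)
  show "hnorm V ((a \<odot>\<^bsub>bounded_ops V\<^esub> T) x) \<le> norm a * opnorm V T * hnorm V x" if "x \<in> carrier V" for x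
    using that assms hnorm_le_opnorm[OF assms that]
    by (simp add: bounded_ops_simps(6) hnorm_smult mult_left_mono mult.assoc)
qed (use assms opnorm_nonneg in auto)

text \<open>\<open>adj\<close> is a definite description, so existence and uniqueness are both
  required. Existence is Riesz representation of x \<mapsto> <T x, y> for each y.\<close>

lemma adj_exists:
  assumes T: "T \<in> carrier (bounded_ops V)"
  shows "\<exists>!S. S \<in> carrier (bounded_ops V) \<and>
     (\<forall>x\<in>carrier V. \<forall>y\<in>carrier V. cinner V (T x) y = cinner V x (S y))"
proof (rule ex_ex1I)
  obtain c where c0: "c \<ge> 0" and c: "\<And>x. x \<in> carrier V \<Longrightarrow> hnorm V (T x) \<le> c * hnorm V x"
    using op_bound[OF T] by blast
  have "\<exists>w\<in>carrier V. \<forall>x\<in>carrier V. cinner V (T x) y = cinner V x w" if y: "y \<in> carrier V" for y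
  proof (rule Riesz_representation[of "\<lambda>x. cinner V (T x) y" "c * hnorm V y"])
    fix x assume x: "x \<in> carrier V"
    have "norm (cinner V (T x) y) \<le> hnorm V (T x) * hnorm V y"
      by (rule Cauchy_Schwarz) (use T x y in auto)
    also have "\<dots> \<le> c * hnorm V x * hnorm V y" using c[OF x] y by (intro mult_right_mono) auto
    finally show "norm (cinner V (T x) y) \<le> c * hnorm V y * hnorm V x" by (simp add: mult_ac)
  qed (use T y in \<open>auto simp: op_add op_smult cinner_simps\<close>)
  then obtain S where S: "\<And>y. y \<in> carrier V \<Longrightarrow> S y \<in> carrier V"
    and TS: "\<And>x y. \<lbrakk>x \<in> carrier V; y \<in> carrier V\<rbrakk> \<Longrightarrow> cinner V (T x) y = cinner V x (S y)"
    by metis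
  have S': "cinner V (S y) x = cinner V y (T x)" if "x \<in> carrier V" "y \<in> carrier V" for x y
    using TS[OF that] that cinner_commute[of x "S y"] cinner_commute[of "T x" y] S T by simp
  have "(\<lambda>y\<in>carrier V. S y) \<in> carrier (bounded_ops V)"
  proof (rule op_inI[where c = c])
    fix y assume y: "y \<in> carrier V"
    \<comment> \<open>Here <S y, S y> = <T (S y), y>; Cauchy-Schwarz and cancelling one factor |S y|
      give S the same bound c as T.\<close>
    have "(hnorm V (S y))\<^sup>2 = norm (cinner V (T (S y)) y)"
      using TS[OF S y] S y by (simp add: cinner_self norm_power)
    also have "\<dots> \<le> hnorm V (T (S y)) * hnorm V y"
      by (rule Cauchy_Schwarz) (use T S y in auto)
    also have "\<dots> \<le> c * hnorm V (S y) * hnorm V y" using c[OF S[OF y]] y by (intro mult_right_mono) auto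
    finally have "hnorm V (S y) * hnorm V (S y) \<le> hnorm V (S y) * (c * hnorm V y)"
      by (simp add: power2_eq_square mult_ac)
    then have "hnorm V (S y) \<le> c * hnorm V y"
      using hnorm_nonneg[OF S[OF y]] hnorm_nonneg[OF y] c0
      by (metis mult_le_cancel_left_pos order_le_less mult_nonneg_nonneg)
    then show "hnorm V ((\<lambda>y\<in>carrier V. S y) y) \<le> c * hnorm V y" using y by simp
  qed (use S S' T in \<open>auto simp: cinner_simps\<close>)
  then show "\<exists>S. S \<in> carrier (bounded_ops V) \<and>
     (\<forall>x\<in>carrier V. \<forall>y\<in>carrier V. cinner V (T x) y = cinner V x (S y))"
    using TS by (intro exI[of _ "\<lambda>y\<in>carrier V. S y"]) auto
next
  fix S S'
  assume S: "S \<in> carrier (bounded_ops V) \<and> (\<forall>x\<in>carrier V. \<forall>y\<in>carrier V. cinner V (T x) y = cinner V x (S y))"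
    and S': "S' \<in> carrier (bounded_ops V) \<and> (\<forall>x\<in>carrier V. \<forall>y\<in>carrier V. cinner V (T x) y = cinner V x (S' y))"
  show "S = S'"
  proof (rule op_eqI)
    fix x y assume "x \<in> carrier V" "y \<in> carrier V"
    then show "cinner V (S x) y = cinner V (S' x) y"
      using S S' cinner_commute[of y "S x"] cinner_commute[of y "S' x"] by auto
  qed (use S S' in auto)
qed

lemma adj_in [simp, intro]: "T \<in> carrier (bounded_ops V) \<Longrightarrow> adj V T \<in> carrier (bounded_ops V)"
  using theI'[OF adj_exists] unfolding adj_def by blast

lemma cinner_adj:
  "\<lbrakk>T \<in> carrier (bounded_ops V); x \<in> carrier V; y \<in> carrier V\<rbrakk> \<Longrightarrow>
    cinner V (T x) y = cinner V x (adj V T y)"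
  using theI'[OF adj_exists] unfolding adj_def by blast

lemma cinner_adj':
  "\<lbrakk>T \<in> carrier (bounded_ops V); x \<in> carrier V; y \<in> carrier V\<rbrakk> \<Longrightarrow>
    cinner V (adj V T x) y = cinner V x (T y)"
  using cinner_adj[of T y x] cinner_commute[of y "adj V T x"] cinner_commute[of "T y" x] by simp

lemma adj_smult:
  assumes T: "T \<in> carrier (bounded_ops V)"
  shows "adj V (a \<odot>\<^bsub>bounded_ops V\<^esub> T) = cnj a \<odot>\<^bsub>bounded_ops V\<^esub> adj V T"
  by (rule op_eqI) (use T in \<open>auto simp: cinner_adj' cinner_smult_op smult_op_apply cinner_simps\<close>)

end

text \<open>Summability and value are proved together, because the induction step for the value uses
  summability of the sum over the smaller index set.\<close>

lemma infsum_finite_sum: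
  fixes f :: "'g \<Rightarrow> 'i \<Rightarrow> real"
  assumes "finite G" "\<And>g. g \<in> G \<Longrightarrow> f g summable_on A"
  shows "(\<lambda>i. \<Sum>g\<in>G. f g i) summable_on A \<and> (\<Sum>\<^sub>\<infinity>i\<in>A. \<Sum>g\<in>G. f g i) = (\<Sum>g\<in>G. infsum (f g) A)"
  using assms
  by (induction G rule: finite_induct) (auto intro: summable_on_add simp: infsum_add)

section \<open>The Hilbert space tensor product\<close>

text \<open>By Parseval in \<open>E\<close> and Bessel in \<open>K\<close>, both sides are sums of \<open>|\<langle>c, R b\<rangle>|\<^sup>2\<close> over \<open>b\<close> and \<open>c\<close>.\<close>

lemma Hilbert_Schmidt_adjoint:
  assumes "hilbert_space K" "hilbert_space E"
    and R: "\<And>v. v \<in> carrier E \<Longrightarrow> R v \<in> carrier K"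
    and R': "\<And>y. y \<in> carrier K \<Longrightarrow> R' y \<in> carrier E"
    and rel: "\<And>v y. \<lbrakk>v \<in> carrier E; y \<in> carrier K\<rbrakk> \<Longrightarrow> cinner K y (R v) = cinner E v (R' y)"
    and sum: "(\<lambda>b. (hnorm K (R b))\<^sup>2) summable_on some_basis E"
    and C: "orthonormal K C"
  shows "(\<lambda>c. (hnorm E (R' c))\<^sup>2) summable_on C"
    "(\<Sum>\<^sub>\<infinity>c\<in>C. (hnorm E (R' c))\<^sup>2) \<le> (\<Sum>\<^sub>\<infinity>b\<in>some_basis E. (hnorm K (R b))\<^sup>2)"
proof -
  interpret K: hilbert_space K by fact
  interpret E: hilbert_space E by fact
  let ?B = "some_basis E"
  have fin: "(\<Sum>c\<in>G. (hnorm E (R' c))\<^sup>2) \<le> (\<Sum>\<^sub>\<infinity>b\<in>?B. (hnorm K (R b))\<^sup>2)" if G: "finite G" "G \<subseteq> C" for G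
  proof -
    have on: "orthonormal K G" using K.orthonormal_subset[OF C G(2)] .
    then have GK: "G \<subseteq> carrier K" by (simp add: orthonormal_def)
    \<comment> \<open>Only finitely many c are treated at a time, so the exchange of sums is plain
      additivity. The bound does not depend on G, which later extends it to all of C.\<close>
    have swap: "(\<lambda>b. \<Sum>c\<in>G. (norm (cinner E (R' c) b))\<^sup>2) summable_on ?B \<and>
        (\<Sum>\<^sub>\<infinity>b\<in>?B. \<Sum>c\<in>G. (norm (cinner E (R' c) b))\<^sup>2) =
        (\<Sum>c\<in>G. \<Sum>\<^sub>\<infinity>b\<in>?B. (norm (cinner E (R' c) b))\<^sup>2)"
    proof (rule infsum_finite_sum[OF G(1)])
      fix c assume "c \<in> G"
      then have "R' c \<in> carrier E" using GK R' by blast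
      then show "(\<lambda>b. (norm (cinner E (R' c) b))\<^sup>2) summable_on ?B"
        by (rule E.Bessel(1)[OF E.orthonormal_some_basis])
    qed
    have "(\<Sum>c\<in>G. (hnorm E (R' c))\<^sup>2) = (\<Sum>c\<in>G. \<Sum>\<^sub>\<infinity>b\<in>?B. (norm (cinner E (R' c) b))\<^sup>2)"
      using GK E.Parseval[OF R'] by (intro sum.cong) auto
    also have "\<dots> = (\<Sum>\<^sub>\<infinity>b\<in>?B. \<Sum>c\<in>G. (norm (cinner E (R' c) b))\<^sup>2)"
      using swap by simp
    also have "\<dots> \<le> (\<Sum>\<^sub>\<infinity>b\<in>?B. (hnorm K (R b))\<^sup>2)"
    proof (rule infsum_mono[OF _ sum])
      show "(\<lambda>b. \<Sum>c\<in>G. (norm (cinner E (R' c) b))\<^sup>2) summable_on ?B"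
        using swap by simp
      fix b assume b: "b \<in> ?B"
      have "(\<Sum>c\<in>G. (norm (cinner E (R' c) b))\<^sup>2) = (\<Sum>c\<in>G. (norm (cinner K (R b) c))\<^sup>2)"
      proof (rule sum.cong)
        fix c assume "c \<in> G"
        then have c: "c \<in> carrier K" using GK by auto
        have "cinner E (R' c) b = cnj (cinner K c (R b))"
          using rel[of b c] b c R' E.cinner_commute[of b "R' c"] by simp
        also have "\<dots> = cinner K (R b) c"
          using K.cinner_commute[OF c R] b by simp
        finally show "(norm (cinner E (R' c) b))\<^sup>2 = (norm (cinner K (R b) c))\<^sup>2" by simp
      qed simp
      also have "\<dots> \<le> (hnorm K (R b))\<^sup>2" by (rule K.Bessel_finite[OF G(1) on]) (use R b in auto)
      finally show "(\<Sum>c\<in>G. (norm (cinner E (R' c) b))\<^sup>2) \<le> (hnorm K (R b))\<^sup>2" .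
    qed
    finally show ?thesis .
  qed
  from bdd_sums_summable[OF _ this]
  show "(\<lambda>c. (hnorm E (R' c))\<^sup>2) summable_on C"
    "(\<Sum>\<^sub>\<infinity>c\<in>C. (hnorm E (R' c))\<^sup>2) \<le> (\<Sum>\<^sub>\<infinity>b\<in>?B. (hnorm K (R b))\<^sup>2)"
    by auto
qed

lemma hilb_tensor_simps:
  "S \<in> carrier (hilb_tensor K E) \<longleftrightarrow> S \<in> carrier E \<rightarrow>\<^sub>E carrier K \<and>
        (\<forall>x\<in>carrier E. \<forall>y\<in>carrier E. S (x \<oplus>\<^bsub>E\<^esub> y) = S x \<oplus>\<^bsub>K\<^esub> S y) \<and>
        (\<forall>a. \<forall>x\<in>carrier E. S (a \<odot>\<^bsub>E\<^esub> x) = cnj a \<odot>\<^bsub>K\<^esub> S x) \<and>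
        (\<exists>c. \<forall>x\<in>carrier E. hnorm K (S x) \<le> c * hnorm E x) \<and>
        (\<lambda>b. (hnorm K (S b))\<^sup>2) summable_on some_basis E"
  "\<zero>\<^bsub>hilb_tensor K E\<^esub> = (\<lambda>x\<in>carrier E. \<zero>\<^bsub>K\<^esub>)"
  "S \<oplus>\<^bsub>hilb_tensor K E\<^esub> T = (\<lambda>x\<in>carrier E. S x \<oplus>\<^bsub>K\<^esub> T x)"
  "a \<odot>\<^bsub>hilb_tensor K E\<^esub> S = (\<lambda>x\<in>carrier E. a \<odot>\<^bsub>K\<^esub> S x)"
  "cinner (hilb_tensor K E) S T = (\<Sum>\<^sub>\<infinity>b\<in>some_basis E. cinner K (S b) (T b))"
  by (simp_all add: hilb_tensor_def)

locale hilbert_pair = K: hilbert_space K + E: hilbert_space E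
  for K :: "'k hilb" and E :: "'e hilb"
begin

abbreviation T :: "('e \<Rightarrow> 'k) hilb" where "T \<equiv> hilb_tensor K E"

lemma tensor_in [simp]: "\<lbrakk>S \<in> carrier T; v \<in> carrier E\<rbrakk> \<Longrightarrow> S v \<in> carrier K"
  unfolding hilb_tensor_simps by auto

lemma tensor_add: "\<lbrakk>S \<in> carrier T; v \<in> carrier E; w \<in> carrier E\<rbrakk> \<Longrightarrow> S (v \<oplus>\<^bsub>E\<^esub> w) = S v \<oplus>\<^bsub>K\<^esub> S w"
  unfolding hilb_tensor_simps by auto

lemma tensor_smult: "\<lbrakk>S \<in> carrier T; v \<in> carrier E\<rbrakk> \<Longrightarrow> S (a \<odot>\<^bsub>E\<^esub> v) = cnj a \<odot>\<^bsub>K\<^esub> S v"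
  unfolding hilb_tensor_simps by auto

lemma tensor_summable: "S \<in> carrier T \<Longrightarrow> (\<lambda>b. (hnorm K (S b))\<^sup>2) summable_on some_basis E"
  unfolding hilb_tensor_simps by auto

lemma tensor_bound:
  assumes "S \<in> carrier T"
  obtains c where "\<And>v. v \<in> carrier E \<Longrightarrow> hnorm K (S v) \<le> c * hnorm E v"
  using assms unfolding hilb_tensor_simps by metis

lemma tensor_undefined: "\<lbrakk>S \<in> carrier T; v \<notin> carrier E\<rbrakk> \<Longrightarrow> S v = undefined"
  unfolding hilb_tensor_simps by auto

lemma tensor_eqI:
  assumes "S \<in> carrier T" "S' \<in> carrier T"
    and "\<And>v y. \<lbrakk>v \<in> carrier E; y \<in> carrier K\<rbrakk> \<Longrightarrow> cinner K (S v) y = cinner K (S' v) y"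
  shows "S = S'"
proof
  show "S v = S' v" for v
    using assms K.vec_eqI[of "S v" "S' v"] by (cases "v \<in> carrier E") (auto simp: tensor_undefined)
qed

lemma tensor_inI:
  assumes "\<And>v. v \<in> carrier E \<Longrightarrow> S v \<in> carrier K" "\<And>v. v \<notin> carrier E \<Longrightarrow> S v = undefined"
    and "\<And>v w y. \<lbrakk>v \<in> carrier E; w \<in> carrier E; y \<in> carrier K\<rbrakk> \<Longrightarrow>
      cinner K (S (v \<oplus>\<^bsub>E\<^esub> w)) y = cinner K (S v) y + cinner K (S w) y"
    and "\<And>a v y. \<lbrakk>v \<in> carrier E; y \<in> carrier K\<rbrakk> \<Longrightarrow>
      cinner K (S (a \<odot>\<^bsub>E\<^esub> v)) y = cnj a * cinner K (S v) y"
    and "\<And>v. v \<in> carrier E \<Longrightarrow> hnorm K (S v) \<le> c * hnorm E v"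
    and "(\<lambda>b. (hnorm K (S b))\<^sup>2) summable_on some_basis E"
  shows "S \<in> carrier T"
  unfolding hilb_tensor_simps
proof (intro conjI ballI allI)
  show "S \<in> carrier E \<rightarrow>\<^sub>E carrier K" using assms by auto
  show "S (x \<oplus>\<^bsub>E\<^esub> y) = S x \<oplus>\<^bsub>K\<^esub> S y" if "x \<in> carrier E" "y \<in> carrier E" for x y
    by (rule K.vec_eqI) (use assms that in \<open>auto simp: K.cinner_simps\<close>)
  show "S (a \<odot>\<^bsub>E\<^esub> x) = cnj a \<odot>\<^bsub>K\<^esub> S x" if "x \<in> carrier E" for a x
    by (rule K.vec_eqI) (use assms that in \<open>auto simp: K.cinner_simps\<close>)
  show "\<exists>c. \<forall>x\<in>carrier E. hnorm K (S x) \<le> c * hnorm E x" using assms(5) by blast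
qed (rule assms)

lemma tensor_smult_in:
  assumes S: "S \<in> carrier T"
  shows "a \<odot>\<^bsub>T\<^esub> S \<in> carrier T"
proof -
  obtain c where c: "\<And>v. v \<in> carrier E \<Longrightarrow> hnorm K (S v) \<le> c * hnorm E v"
    using tensor_bound[OF S] by blast
  show ?thesis
  proof (rule tensor_inI[where c = "norm a * c"])
    show "hnorm K ((a \<odot>\<^bsub>T\<^esub> S) v) \<le> norm a * c * hnorm E v" if "v \<in> carrier E" for v
      using that S c[OF that] by (simp add: hilb_tensor_simps(4) K.hnorm_smult mult.assoc mult_left_mono)
    have "(\<lambda>b. (norm a)\<^sup>2 * (hnorm K (S b))\<^sup>2) summable_on some_basis E"
      by (intro summable_on_cmult_right tensor_summable S)
    then show "(\<lambda>b. (hnorm K ((a \<odot>\<^bsub>T\<^esub> S) b))\<^sup>2) summable_on some_basis E"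
      by (rule summable_on_cong[THEN iffD1, rotated])
        (use S in \<open>simp add: hilb_tensor_simps(4) K.hnorm_smult power_mult_distrib\<close>)
  qed (use S in \<open>auto simp: hilb_tensor_simps(4) tensor_add tensor_smult K.cinner_simps distrib_left\<close>)
qed

lemma tensor_add_in:
  assumes S: "S \<in> carrier T" and S': "S' \<in> carrier T"
  shows "S \<oplus>\<^bsub>T\<^esub> S' \<in> carrier T"
proof -
  obtain c where c: "\<And>v. v \<in> carrier E \<Longrightarrow> hnorm K (S v) \<le> c * hnorm E v"
    using tensor_bound[OF S] by blast
  obtain d where d: "\<And>v. v \<in> carrier E \<Longrightarrow> hnorm K (S' v) \<le> d * hnorm E v"
    using tensor_bound[OF S'] by blast
  show ?thesis
  proof (rule tensor_inI[where c = "c + d"])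
    show "hnorm K ((S \<oplus>\<^bsub>T\<^esub> S') v) \<le> (c + d) * hnorm E v" if "v \<in> carrier E" for v
      using that S S' c[OF that] d[OF that] K.hnorm_triangle[of "S v" "S' v"]
      by (simp add: hilb_tensor_simps(3) distrib_right)
    have "(\<lambda>b. 2 * (hnorm K (S b))\<^sup>2 + 2 * (hnorm K (S' b))\<^sup>2) summable_on some_basis E"
      by (intro summable_on_cmult_right summable_on_add tensor_summable S S')
    then show "(\<lambda>b. (hnorm K ((S \<oplus>\<^bsub>T\<^esub> S') b))\<^sup>2) summable_on some_basis E"
      by (rule summable_on_comparison_test)
        (use S S' K.hnorm_sq_add_le in \<open>auto simp: hilb_tensor_simps(3)\<close>)
  qed (use S S' in \<open>auto simp: hilb_tensor_simps(3) tensor_add tensor_smult K.cinner_simps distrib_left\<close>)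
qed

lemma tensor_zero_in: "\<zero>\<^bsub>T\<^esub> \<in> carrier T"
proof (rule tensor_inI[where c = 0])
  show "(\<lambda>b. (hnorm K (\<zero>\<^bsub>T\<^esub> b))\<^sup>2) summable_on some_basis E"
    by (rule summable_on_0) (simp add: hilb_tensor_simps(2))
qed (auto simp: hilb_tensor_simps(2))

lemmas tensor_ops_in = tensor_zero_in tensor_add_in tensor_smult_in

lemma tensor_apply:
  assumes "v \<in> carrier E"
  shows "\<zero>\<^bsub>T\<^esub> v = \<zero>\<^bsub>K\<^esub>" "(S \<oplus>\<^bsub>T\<^esub> S') v = S v \<oplus>\<^bsub>K\<^esub> S' v" "(a \<odot>\<^bsub>T\<^esub> S) v = a \<odot>\<^bsub>K\<^esub> S v"
  using assms by (simp_all add: hilb_tensor_simps(2-4))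

lemma module_tensor: "module complex_field T"
proof (rule moduleI)
  show "cring complex_field" by (rule cring_complex_field)
  show "abelian_group T"
  proof (rule abelian_groupI)
    fix S S' S''
    assume S: "S \<in> carrier T"
    show "\<exists>S'\<in>carrier T. S' \<oplus>\<^bsub>T\<^esub> S = \<zero>\<^bsub>T\<^esub>"
      using S by (intro bexI[of _ "(-1) \<odot>\<^bsub>T\<^esub> S"] tensor_eqI)
        (auto simp: tensor_apply K.cinner_simps tensor_ops_in)
    show "\<zero>\<^bsub>T\<^esub> \<oplus>\<^bsub>T\<^esub> S = S"
      using S by (intro tensor_eqI) (auto simp: tensor_apply K.cinner_simps tensor_ops_in)
    assume S': "S' \<in> carrier T"
    show "S \<oplus>\<^bsub>T\<^esub> S' = S' \<oplus>\<^bsub>T\<^esub> S"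
      using S S' by (intro tensor_eqI) (auto simp: tensor_apply K.cinner_simps tensor_ops_in)
    assume S'': "S'' \<in> carrier T"
    show "S \<oplus>\<^bsub>T\<^esub> S' \<oplus>\<^bsub>T\<^esub> S'' = S \<oplus>\<^bsub>T\<^esub> (S' \<oplus>\<^bsub>T\<^esub> S'')"
      using S S' S'' by (intro tensor_eqI) (auto simp: tensor_apply K.cinner_simps tensor_ops_in)
  qed (auto intro: tensor_ops_in)
  show "(a \<oplus>\<^bsub>complex_field\<^esub> b) \<odot>\<^bsub>T\<^esub> S = a \<odot>\<^bsub>T\<^esub> S \<oplus>\<^bsub>T\<^esub> b \<odot>\<^bsub>T\<^esub> S" if "S \<in> carrier T" for a b S
    using that by (intro tensor_eqI) (auto simp: tensor_apply K.cinner_simps tensor_ops_in algebra_simps)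
  show "a \<odot>\<^bsub>T\<^esub> (S \<oplus>\<^bsub>T\<^esub> S') = a \<odot>\<^bsub>T\<^esub> S \<oplus>\<^bsub>T\<^esub> a \<odot>\<^bsub>T\<^esub> S'" if "S \<in> carrier T" "S' \<in> carrier T" for a S S'
    using that by (intro tensor_eqI) (auto simp: tensor_apply K.cinner_simps tensor_ops_in algebra_simps)
  show "(a \<otimes>\<^bsub>complex_field\<^esub> b) \<odot>\<^bsub>T\<^esub> S = a \<odot>\<^bsub>T\<^esub> (b \<odot>\<^bsub>T\<^esub> S)" if "S \<in> carrier T" for a b S
    using that by (intro tensor_eqI) (auto simp: tensor_apply K.cinner_simps tensor_ops_in algebra_simps)
  show "\<one>\<^bsub>complex_field\<^esub> \<odot>\<^bsub>T\<^esub> S = S" if "S \<in> carrier T" for S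
    using that by (intro tensor_eqI) (auto simp: tensor_apply K.cinner_simps tensor_ops_in algebra_simps)
qed (auto intro: tensor_ops_in)

text \<open>Because S is conjugate-linear and the second argument of the inner product is too, v
  \<mapsto> <y, S v> is linear and bounded, so Riesz representation in E applies. The relation is
  symmetric: it also says that S is the conjugate-linear adjoint of S'.\<close>

lemma conj_adjoint_exists:
  assumes S: "S \<in> carrier T"
  obtains S' where "\<And>y. y \<in> carrier K \<Longrightarrow> S' y \<in> carrier E"
    "\<And>v y. \<lbrakk>v \<in> carrier E; y \<in> carrier K\<rbrakk> \<Longrightarrow> cinner K y (S v) = cinner E v (S' y)"
proof -
  obtain c where c: "\<And>v. v \<in> carrier E \<Longrightarrow> hnorm K (S v) \<le> c * hnorm E v"
    using tensor_bound[OF S] by blast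
  have "\<exists>w\<in>carrier E. \<forall>v\<in>carrier E. cinner K y (S v) = cinner E v w" if y: "y \<in> carrier K" for y
  proof (rule E.Riesz_representation[of "\<lambda>v. cinner K y (S v)" "hnorm K y * c"])
    fix v assume v: "v \<in> carrier E"
    have "norm (cinner K y (S v)) \<le> hnorm K y * hnorm K (S v)"
      by (rule K.Cauchy_Schwarz) (use S v y in auto)
    also have "\<dots> \<le> hnorm K y * (c * hnorm E v)" using c[OF v] y by (intro mult_left_mono) auto
    finally show "norm (cinner K y (S v)) \<le> hnorm K y * c * hnorm E v" by (simp add: mult_ac)
  qed (use S y in \<open>auto simp: tensor_add tensor_smult K.cinner_simps\<close>)
  then show thesis using that by metis
qed

lemma tensor_cinner_summable:
  assumes S: "S \<in> carrier T" and S': "S' \<in> carrier T"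
  shows "(\<lambda>b. cinner K (S b) (S' b)) summable_on some_basis E"
proof (rule abs_summable_summable, rule summable_on_norm_bound)
  show "(\<lambda>b. hnorm K (S b) * hnorm K (S' b)) summable_on some_basis E"
    by (intro summable_on_mult_of_squares tensor_summable S S')
qed (use S S' in \<open>auto intro: K.Cauchy_Schwarz\<close>)

lemma tensor_cinner_self:
  assumes S: "S \<in> carrier T"
  shows "cinner T S S = complex_of_real (\<Sum>\<^sub>\<infinity>b\<in>some_basis E. (hnorm K (S b))\<^sup>2)"
  unfolding hilb_tensor_simps infsum_complex_of_real[OF tensor_summable[OF S], symmetric]
  using S by (intro infsum_cong K.cinner_self) auto

text \<open>Parseval gives |S' y|^2 as the sum of |<y, S b>|^2 over the basis, which is at most
  |y|^2 times the squared Hilbert-Schmidt norm of S. This controls S at every vector and not only at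
  basis vectors, as definiteness and completeness require.\<close>

lemma tensor_pointwise_bound:
  assumes S: "S \<in> carrier T" and v: "v \<in> carrier E"
  shows "hnorm K (S v) \<le> hnorm T S * hnorm E v"
proof -
  define N where "N = (\<Sum>\<^sub>\<infinity>b\<in>some_basis E. (hnorm K (S b))\<^sup>2)"
  have hT: "hnorm T S = sqrt N" by (simp add: hnorm_def tensor_cinner_self[OF S] N_def)
  have N0: "N \<ge> 0" unfolding N_def by (intro infsum_nonneg) simp
  obtain S' where S': "\<And>y. y \<in> carrier K \<Longrightarrow> S' y \<in> carrier E"
    and rel: "\<And>v y. \<lbrakk>v \<in> carrier E; y \<in> carrier K\<rbrakk> \<Longrightarrow> cinner K y (S v) = cinner E v (S' y)"
    using conj_adjoint_exists[OF S] by blast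
  \<comment> \<open>With this y, |S v|^2 = <y, S v> = <v, S' y>, so the bound on S' y transfers to S
    v after cancelling one factor |y|.\<close>
  define y where "y = S v"
  have y: "y \<in> carrier K" using S v by (simp add: y_def)
  have "(hnorm E (S' y))\<^sup>2 = (\<Sum>\<^sub>\<infinity>b\<in>some_basis E. (norm (cinner E (S' y) b))\<^sup>2)"
    by (rule E.Parseval[symmetric]) (rule S'[OF y])
  also have "\<dots> \<le> (\<Sum>\<^sub>\<infinity>b\<in>some_basis E. (hnorm K y)\<^sup>2 * (hnorm K (S b))\<^sup>2)"
  proof (rule infsum_mono)
    show "(\<lambda>b. (norm (cinner E (S' y) b))\<^sup>2) summable_on some_basis E"
      by (rule E.Bessel[OF E.orthonormal_some_basis S'[OF y]])
    show "(\<lambda>b. (hnorm K y)\<^sup>2 * (hnorm K (S b))\<^sup>2) summable_on some_basis E"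
      by (intro summable_on_cmult_right tensor_summable S)
    fix b assume b: "b \<in> some_basis E"
    have "norm (cinner E (S' y) b) = norm (cinner K y (S b))"
      using rel[of b y] b y S' E.cinner_commute[of b "S' y"] by simp
    also have "\<dots> \<le> hnorm K y * hnorm K (S b)" using y S b by (intro K.Cauchy_Schwarz) auto
    finally show "(norm (cinner E (S' y) b))\<^sup>2 \<le> (hnorm K y)\<^sup>2 * (hnorm K (S b))\<^sup>2"
      by (metis norm_ge_zero power_mono power_mult_distrib)
  qed
  also have "\<dots> = (hnorm K y * sqrt N)\<^sup>2"
    unfolding N_def[symmetric] using N0 by (simp add: infsum_cmult_right' N_def[symmetric] power_mult_distrib)
  finally have S'y: "hnorm E (S' y) \<le> hnorm K y * sqrt N"
    by (rule power2_le_imp_le) (use y N0 in auto)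
  have "hnorm K y * hnorm K y = norm (cinner K y (S v))"
    using y K.cinner_self[OF y] by (simp add: y_def[symmetric] norm_power power2_eq_square norm_mult)
  also have "\<dots> = norm (cinner E v (S' y))" using rel[OF v y] by simp
  also have "\<dots> \<le> hnorm E v * hnorm E (S' y)" by (rule E.Cauchy_Schwarz[OF v S'[OF y]])
  also have "\<dots> \<le> hnorm E v * (hnorm K y * sqrt N)" using S'y v by (intro mult_left_mono) auto
  finally have "hnorm K y * hnorm K y \<le> hnorm K y * (hnorm T S * hnorm E v)"
    by (simp add: hT mult_ac)
  then show ?thesis
    unfolding y_def[symmetric] using K.hnorm_nonneg[OF y] N0 v
    by (cases "hnorm K y = 0") (auto simp: hT)
qed

lemma pre_hilbert_tensor: "pre_hilbert_space T"
proof (intro pre_hilbert_space.intro module_tensor pre_hilbert_space_axioms.intro)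
  fix S S' S'' assume S: "S \<in> carrier T"
  assume S': "S' \<in> carrier T"
  show "cinner T S' S = cnj (cinner T S S')"
    unfolding hilb_tensor_simps(5) infsum_cnj[symmetric]
    using S S' by (intro infsum_cong) (auto intro: K.cinner_commute)
  show "cinner T (a \<odot>\<^bsub>T\<^esub> S) S' = a * cinner T S S'" for a
    unfolding hilb_tensor_simps(5) infsum_cmult_right'[symmetric]
    using S S' by (intro infsum_cong) (auto simp: tensor_apply K.cinner_simps)
  assume S'': "S'' \<in> carrier T"
  show "cinner T (S \<oplus>\<^bsub>T\<^esub> S') S'' = cinner T S S'' + cinner T S' S''"
    unfolding hilb_tensor_simps(5)
      infsum_add[OF tensor_cinner_summable[OF S S''] tensor_cinner_summable[OF S' S''], symmetric]
    using S S' S'' by (intro infsum_cong) (auto simp: tensor_apply K.cinner_simps)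
next
  fix S assume S: "S \<in> carrier T" and nz: "S \<noteq> \<zero>\<^bsub>T\<^esub>"
  have "hnorm T S \<noteq> 0"
  proof
    assume 0: "hnorm T S = 0"
    have "S v = \<zero>\<^bsub>K\<^esub>" if v: "v \<in> carrier E" for v
    proof -
      have "hnorm K (S v) = 0"
        using tensor_pointwise_bound[OF S v] 0 K.hnorm_nonneg[OF tensor_in[OF S v]] by simp
      then show ?thesis using S v by (simp add: K.hnorm_eq_0)
    qed
    then have "S = \<zero>\<^bsub>T\<^esub>" using S by (intro tensor_eqI tensor_zero_in) (auto simp: tensor_apply)
    with nz show False ..
  qed
  moreover have "0 \<le> Re (cinner T S S)"
    unfolding tensor_cinner_self[OF S] by (auto intro: infsum_nonneg)
  ultimately show "0 < Re (cinner T S S)" by (simp add: hnorm_def)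
qed

sublocale T: pre_hilbert_space T
  by (rule pre_hilbert_tensor)

lemma tensor_hnorm_sq: "S \<in> carrier T \<Longrightarrow> (hnorm T S)\<^sup>2 = (\<Sum>\<^sub>\<infinity>b\<in>some_basis E. (hnorm K (S b))\<^sup>2)"
  by (simp add: T.hnorm_sq tensor_cinner_self)

lemma tensor_minus_apply:
  assumes "S \<in> carrier T" "S' \<in> carrier T" "v \<in> carrier E"
  shows "(S \<ominus>\<^bsub>T\<^esub> S') v = S v \<ominus>\<^bsub>K\<^esub> S' v"
proof (rule K.vec_eqI)
  fix y assume y: "y \<in> carrier K"
  have "(S \<ominus>\<^bsub>T\<^esub> S') \<oplus>\<^bsub>T\<^esub> S' = S"
    by (rule T.vec_eqI) (use assms in \<open>auto simp: T.cinner_simps\<close>)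
  then have "S v = (S \<ominus>\<^bsub>T\<^esub> S') v \<oplus>\<^bsub>K\<^esub> S' v" using assms tensor_apply(2) by metis
  then show "cinner K ((S \<ominus>\<^bsub>T\<^esub> S') v) y = cinner K (S v \<ominus>\<^bsub>K\<^esub> S' v) y"
    using assms y by (simp add: K.cinner_simps)
qed (use assms in auto)

text \<open>A Cauchy sequence converges pointwise by \<open>tensor_pointwise_bound\<close>, but it
  is not clear in advance that the limit L is Hilbert-Schmidt. The remainders S n - L are therefore
  shown to lie in T with small norm, by letting m tend to infinity in the estimates for S n - S m; L
  is then a difference of two elements of T.\<close>

lemma hilbert_space_tensor: "hilbert_space T"
proof (rule hilbert_spaceI[OF pre_hilbert_tensor T.mcompleteI])
  fix S :: "nat \<Rightarrow> 'e \<Rightarrow> 'k"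
  assume S: "\<And>n. S n \<in> carrier T"
    and C: "\<And>e. e > 0 \<Longrightarrow> \<exists>N. \<forall>m\<ge>N. \<forall>n\<ge>N. hnorm T (S m \<ominus>\<^bsub>T\<^esub> S n) < e"
  have diff: "hnorm K (S m v \<ominus>\<^bsub>K\<^esub> S n v) \<le> hnorm T (S m \<ominus>\<^bsub>T\<^esub> S n) * hnorm E v"
    if "v \<in> carrier E" for m n v
    using tensor_pointwise_bound[of "S m \<ominus>\<^bsub>T\<^esub> S n" v] S that by (simp add: tensor_minus_apply)
  have "\<exists>l\<in>carrier K. (\<lambda>n. hnorm K (S n v \<ominus>\<^bsub>K\<^esub> l)) \<longlonglongrightarrow> 0" if v: "v \<in> carrier E" for v
  proof (rule K.Cauchy_limit[of "\<lambda>n. S n v"])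
    fix e :: real assume e: "e > 0"
    have h: "0 \<le> hnorm E v" using v by simp
    \<comment> \<open>Adding 1 avoids a zero denominator for v = 0 and makes the final inequality
      strict.\<close>
    have "e / (hnorm E v + 1) > 0" using h e by (simp add: add_nonneg_pos)
    from C[OF this] obtain N where
      N: "\<And>m n. m \<ge> N \<Longrightarrow> n \<ge> N \<Longrightarrow> hnorm T (S m \<ominus>\<^bsub>T\<^esub> S n) < e / (hnorm E v + 1)" by blast
    have "hnorm K (S m v \<ominus>\<^bsub>K\<^esub> S n v) < e" if "m \<ge> N" "n \<ge> N" for m n
    proof -
      have "hnorm K (S m v \<ominus>\<^bsub>K\<^esub> S n v) \<le> hnorm T (S m \<ominus>\<^bsub>T\<^esub> S n) * hnorm E v" by (rule diff[OF v])
      also have "\<dots> \<le> e / (hnorm E v + 1) * hnorm E v" using N[OF that] h by (intro mult_right_mono) auto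
      also have "\<dots> < e" using h e by (simp add: field_simps)
      finally show ?thesis .
    qed
    then show "\<exists>N. \<forall>m\<ge>N. \<forall>n\<ge>N. hnorm K (S m v \<ominus>\<^bsub>K\<^esub> S n v) < e" by blast
  qed (use S v in auto)
  then obtain L where L: "\<And>v. v \<in> carrier E \<Longrightarrow> L v \<in> carrier K"
    and lim: "\<And>v. v \<in> carrier E \<Longrightarrow> (\<lambda>n. hnorm K (S n v \<ominus>\<^bsub>K\<^esub> L v)) \<longlonglongrightarrow> 0" by metis
  have climL: "(\<lambda>n. cinner K (S n v) y) \<longlonglongrightarrow> cinner K (L v) y" if "v \<in> carrier E" "y \<in> carrier K" for v y
    using that S L lim by (intro K.tendsto_cinner) auto
  have Ladd: "cinner K (L (v \<oplus>\<^bsub>E\<^esub> w)) y = cinner K (L v) y + cinner K (L w) y"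
    if "v \<in> carrier E" "w \<in> carrier E" "y \<in> carrier K" for v w y
  proof (rule LIMSEQ_unique)
    show "(\<lambda>n. cinner K (S n (v \<oplus>\<^bsub>E\<^esub> w)) y) \<longlonglongrightarrow> cinner K (L (v \<oplus>\<^bsub>E\<^esub> w)) y" using that by (intro climL) auto
    have "cinner K (S n (v \<oplus>\<^bsub>E\<^esub> w)) y = cinner K (S n v) y + cinner K (S n w) y" for n
      using that S by (simp add: tensor_add K.cinner_simps)
    then show "(\<lambda>n. cinner K (S n (v \<oplus>\<^bsub>E\<^esub> w)) y) \<longlonglongrightarrow> cinner K (L v) y + cinner K (L w) y"
      using that by (simp only:) (intro tendsto_add climL)
  qed
  have Lsmult: "cinner K (L (a \<odot>\<^bsub>E\<^esub> v)) y = cnj a * cinner K (L v) y"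
    if "v \<in> carrier E" "y \<in> carrier K" for a v y
  proof (rule LIMSEQ_unique)
    show "(\<lambda>n. cinner K (S n (a \<odot>\<^bsub>E\<^esub> v)) y) \<longlonglongrightarrow> cinner K (L (a \<odot>\<^bsub>E\<^esub> v)) y" using that by (intro climL) auto
    have "cinner K (S n (a \<odot>\<^bsub>E\<^esub> v)) y = cnj a * cinner K (S n v) y" for n
      using that S by (simp add: tensor_smult K.cinner_simps)
    then show "(\<lambda>n. cinner K (S n (a \<odot>\<^bsub>E\<^esub> v)) y) \<longlonglongrightarrow> cnj a * cinner K (L v) y"
      using that by (simp only:) (intro tendsto_mult_left climL)
  qed
  \<comment> \<open>For fixed n and v the distances from S n v to S m v converge to the distance to
    L v, so bounds uniform in m survive in the limit.\<close>
  have lim2: "(\<lambda>m. hnorm K (S n v \<ominus>\<^bsub>K\<^esub> S m v)) \<longlonglongrightarrow> hnorm K (S n v \<ominus>\<^bsub>K\<^esub> L v)" if v: "v \<in> carrier E" for n v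
  proof (rule K.tendsto_hnorm)
    have "(S n v \<ominus>\<^bsub>K\<^esub> S m v) \<ominus>\<^bsub>K\<^esub> (S n v \<ominus>\<^bsub>K\<^esub> L v) = L v \<ominus>\<^bsub>K\<^esub> S m v" for m
      by (rule K.vec_eqI) (use S L v in \<open>auto simp: K.cinner_simps\<close>)
    then show "(\<lambda>m. hnorm K ((S n v \<ominus>\<^bsub>K\<^esub> S m v) \<ominus>\<^bsub>K\<^esub> (S n v \<ominus>\<^bsub>K\<^esub> L v))) \<longlonglongrightarrow> 0"
      using lim[OF v] K.hnorm_diff_commute[OF L[OF v], of "S _ v"] S v by simp
  qed (use S L v in auto)
  define D where "D n = (\<lambda>v\<in>carrier E. S n v \<ominus>\<^bsub>K\<^esub> L v)" for n
  have D: "D n \<in> carrier T \<and> hnorm T (D n) \<le> e"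
    if e: "e > 0" and N: "\<And>m. m \<ge> N \<Longrightarrow> hnorm T (S n \<ominus>\<^bsub>T\<^esub> S m) < e" for e N n
  proof -
    \<comment> \<open>The limit in m is taken inside a finite sum, where it is harmless; the bound
      e^2 does not depend on F and so passes to the whole basis.\<close>
    have fin: "(\<Sum>b\<in>F. (hnorm K (D n b))\<^sup>2) \<le> e\<^sup>2" if F: "finite F" "F \<subseteq> some_basis E" for F
    proof (rule LIMSEQ_le_const2)
      have FE: "F \<subseteq> carrier E" using F by auto
      then show "(\<lambda>m. \<Sum>b\<in>F. (hnorm K (S n b \<ominus>\<^bsub>K\<^esub> S m b))\<^sup>2) \<longlonglongrightarrow> (\<Sum>b\<in>F. (hnorm K (D n b))\<^sup>2)"
        by (intro tendsto_sum) (auto simp: D_def intro!: tendsto_power lim2)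
      have "(\<Sum>b\<in>F. (hnorm K (S n b \<ominus>\<^bsub>K\<^esub> S m b))\<^sup>2) \<le> e\<^sup>2" if m: "m \<ge> N" for m
      proof -
        have SS: "S n \<ominus>\<^bsub>T\<^esub> S m \<in> carrier T" using S by auto
        have "(\<Sum>b\<in>F. (hnorm K (S n b \<ominus>\<^bsub>K\<^esub> S m b))\<^sup>2) = (\<Sum>b\<in>F. (hnorm K ((S n \<ominus>\<^bsub>T\<^esub> S m) b))\<^sup>2)"
          using FE S by (intro sum.cong) (auto simp: tensor_minus_apply)
        also have "\<dots> \<le> (hnorm T (S n \<ominus>\<^bsub>T\<^esub> S m))\<^sup>2"
          unfolding tensor_hnorm_sq[OF SS]
          by (rule finite_sum_le_infsum[OF tensor_summable[OF SS]]) (use F in auto)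
        also have "\<dots> \<le> e\<^sup>2" using N[OF m] SS by (intro power_mono) auto
        finally show ?thesis .
      qed
      then show "\<exists>N. \<forall>m\<ge>N. (\<Sum>b\<in>F. (hnorm K (S n b \<ominus>\<^bsub>K\<^esub> S m b))\<^sup>2) \<le> e\<^sup>2" by blast
    qed
    note sm = bdd_sums_summable[OF _ this]
    have "D n \<in> carrier T"
    proof (rule tensor_inI[where c = e])
      fix v assume v: "v \<in> carrier E"
      show "hnorm K (D n v) \<le> e * hnorm E v"
      proof (rule LIMSEQ_le_const2)
        show "(\<lambda>m. hnorm K (S n v \<ominus>\<^bsub>K\<^esub> S m v)) \<longlonglongrightarrow> hnorm K (D n v)" using lim2[OF v] v by (simp add: D_def)
        have "hnorm K (S n v \<ominus>\<^bsub>K\<^esub> S m v) \<le> e * hnorm E v" if "m \<ge> N" for m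
        proof -
          have "hnorm K (S n v \<ominus>\<^bsub>K\<^esub> S m v) \<le> hnorm T (S n \<ominus>\<^bsub>T\<^esub> S m) * hnorm E v" by (rule diff[OF v])
          also have "\<dots> \<le> e * hnorm E v" using N[OF that] v by (intro mult_right_mono) auto
          finally show ?thesis .
        qed
        then show "\<exists>N. \<forall>m\<ge>N. hnorm K (S n v \<ominus>\<^bsub>K\<^esub> S m v) \<le> e * hnorm E v" by blast
      qed
    qed (use S L sm(1) in \<open>auto simp: D_def tensor_add tensor_smult K.cinner_simps Ladd Lsmult right_diff_distrib\<close>)
    moreover have "hnorm T (D n) \<le> e"
      by (rule power2_le_imp_le) (use e sm(2) tensor_hnorm_sq[OF \<open>D n \<in> carrier T\<close>] in auto)
    ultimately show ?thesis ..
  qed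
  obtain N1 where N1: "\<And>m n. m \<ge> N1 \<Longrightarrow> n \<ge> N1 \<Longrightarrow> hnorm T (S m \<ominus>\<^bsub>T\<^esub> S n) < 1" using C[of 1] by auto
  \<comment> \<open>L is known only through its values on \<open>carrier E\<close>. Subtracting the
    remainder \<open>D N1\<close> from \<open>S N1\<close> realises it as an element of T.\<close>
  define l where "l = S N1 \<ominus>\<^bsub>T\<^esub> D N1"
  have D1: "D N1 \<in> carrier T" using D[of 1 N1 N1] N1 by auto
  then have l: "l \<in> carrier T" using S by (simp add: l_def)
  have lv: "l v = L v" if v: "v \<in> carrier E" for v
    by (rule K.vec_eqI) (use S D1 L v in \<open>auto simp: l_def tensor_minus_apply D_def K.cinner_simps\<close>)
  have Dl: "S n \<ominus>\<^bsub>T\<^esub> l = D n" if "D n \<in> carrier T" for n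
    by (rule tensor_eqI) (use S l that lv in \<open>auto simp: tensor_minus_apply D_def\<close>)
  have "(\<lambda>n. hnorm T (S n \<ominus>\<^bsub>T\<^esub> l)) \<longlonglongrightarrow> 0"
  proof (rule LIMSEQ_I)
    fix r :: real assume r: "r > 0"
    \<comment> \<open>\<open>D\<close> yields only a weak inequality, so half of r is used to end
      with a strict one.\<close>
    obtain N where N: "\<And>m n. m \<ge> N \<Longrightarrow> n \<ge> N \<Longrightarrow> hnorm T (S m \<ominus>\<^bsub>T\<^esub> S n) < r / 2" using C[of "r / 2"] r by auto
    have "norm (hnorm T (S n \<ominus>\<^bsub>T\<^esub> l) - 0) < r" if "n \<ge> N" for n
      using D[of "r / 2" N n] N[OF that] r Dl[of n] by auto
    then show "\<exists>N. \<forall>n\<ge>N. norm (hnorm T (S n \<ominus>\<^bsub>T\<^esub> l) - 0) < r" by blast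
  qed
  with l show "\<exists>l\<in>carrier T. (\<lambda>n. hnorm T (S n \<ominus>\<^bsub>T\<^esub> l)) \<longlonglongrightarrow> 0" by blast
qed

sublocale T: hilbert_space T
  by (rule hilbert_space_tensor)

section \<open>The operators X (x) A on the tensor product\<close>

lemma op_tensor_apply:
  "\<lbrakk>S \<in> carrier T; v \<in> carrier E\<rbrakk> \<Longrightarrow> op_tensor K E X A S v = X (S (adj E A v))"
  by (simp add: op_tensor_def)

text \<open>The vectors \<open>adj E A b\<close> form no orthonormal system, so the squares |S (adj
  E A b)|^2 cannot be compared with |S b|^2 term by term. Three moves replace the comparison: from S
  to S' over a basis of K, then A applied on the left of S', then back from A S' to its
  conjugate-linear adjoint over the basis of E. Finally X acts on the left and contributes
  \<open>opnorm K X\<close>.\<close>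

lemma op_tensor_maps:
  assumes X: "X \<in> carrier (bounded_ops K)" and A: "A \<in> carrier (bounded_ops E)" and S: "S \<in> carrier T"
  shows "op_tensor K E X A S \<in> carrier T"
    "hnorm T (op_tensor K E X A S) \<le> opnorm K X * opnorm E A * hnorm T S"
proof -
  let ?B = "some_basis E" and ?C = "some_basis K"
  let ?R = "\<lambda>v. S (adj E A v)"
  obtain S' where S': "\<And>y. y \<in> carrier K \<Longrightarrow> S' y \<in> carrier E"
    and rel: "\<And>v y. \<lbrakk>v \<in> carrier E; y \<in> carrier K\<rbrakk> \<Longrightarrow> cinner K y (S v) = cinner E v (S' y)"
    using conj_adjoint_exists[OF S] by blast
  note s1 = Hilbert_Schmidt_adjoint[OF K.hilbert_space_axioms E.hilbert_space_axioms _ S' rel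
      tensor_summable[OF S] K.orthonormal_some_basis]
  have s1: "(\<lambda>c. (hnorm E (S' c))\<^sup>2) summable_on ?C"
    "(\<Sum>\<^sub>\<infinity>c\<in>?C. (hnorm E (S' c))\<^sup>2) \<le> (hnorm T S)\<^sup>2"
    using s1 S by (simp_all add: tensor_hnorm_sq)
  have le: "(hnorm E (A (S' c)))\<^sup>2 \<le> (opnorm E A)\<^sup>2 * (hnorm E (S' c))\<^sup>2" if "c \<in> ?C" for c
    using E.hnorm_le_opnorm[OF A S'[of c]] S'[of c] that A
    by (simp add: power_mult_distrib[symmetric] power_mono)
  have s2: "(\<lambda>c. (opnorm E A)\<^sup>2 * (hnorm E (S' c))\<^sup>2) summable_on ?C"
    by (intro summable_on_cmult_right s1)
  have s3: "(\<lambda>c. (hnorm E (A (S' c)))\<^sup>2) summable_on ?C"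
    using s2 by (rule summable_on_comparison_test) (use le in auto)
  have "(\<Sum>\<^sub>\<infinity>c\<in>?C. (hnorm E (A (S' c)))\<^sup>2) \<le> (\<Sum>\<^sub>\<infinity>c\<in>?C. (opnorm E A)\<^sup>2 * (hnorm E (S' c))\<^sup>2)"
    by (rule infsum_mono[OF s3 s2 le])
  also have "\<dots> \<le> (opnorm E A)\<^sup>2 * (hnorm T S)\<^sup>2"
    unfolding infsum_cmult_right' by (rule mult_left_mono[OF s1(2)]) simp
  finally have s3': "(\<Sum>\<^sub>\<infinity>c\<in>?C. (hnorm E (A (S' c)))\<^sup>2) \<le> (opnorm E A)\<^sup>2 * (hnorm T S)\<^sup>2" .
  \<comment> \<open>The conjugate-linear adjoint of A after S' is S after \<open>adj E A\<close>.
    This allows \<open>Hilbert_Schmidt_adjoint\<close> to be applied a second time with the roles of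
    K and E exchanged.\<close>
  have rel': "cinner E y (A (S' v)) = cinner K v (?R y)" if "v \<in> carrier K" "y \<in> carrier E" for v y
    using that rel[of "adj E A y" v] A S' E.cinner_adj'[OF A, of y "S' v"] by simp
  have s4: "(\<lambda>b. (hnorm K (?R b))\<^sup>2) summable_on ?B"
    "(\<Sum>\<^sub>\<infinity>b\<in>?B. (hnorm K (?R b))\<^sup>2) \<le> (\<Sum>\<^sub>\<infinity>c\<in>?C. (hnorm E (A (S' c)))\<^sup>2)"
    using Hilbert_Schmidt_adjoint[OF E.hilbert_space_axioms K.hilbert_space_axioms _ _ rel' s3 E.orthonormal_some_basis]
      A S S' by auto
  have le5: "(hnorm K (X (?R b)))\<^sup>2 \<le> (opnorm K X)\<^sup>2 * (hnorm K (?R b))\<^sup>2" if "b \<in> ?B" for b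
    using K.hnorm_le_opnorm[OF X, of "?R b"] that A S X
    by (simp add: power_mult_distrib[symmetric] power_mono)
  have s5: "(\<lambda>b. (opnorm K X)\<^sup>2 * (hnorm K (?R b))\<^sup>2) summable_on ?B"
    by (intro summable_on_cmult_right s4)
  have s6: "(\<lambda>b. (hnorm K (X (?R b)))\<^sup>2) summable_on ?B"
    using s5 by (rule summable_on_comparison_test) (use le5 in auto)
  have "(\<Sum>\<^sub>\<infinity>b\<in>?B. (hnorm K (X (?R b)))\<^sup>2) \<le> (\<Sum>\<^sub>\<infinity>b\<in>?B. (opnorm K X)\<^sup>2 * (hnorm K (?R b))\<^sup>2)"
    by (rule infsum_mono[OF s6 s5 le5])
  also have "\<dots> \<le> (opnorm K X)\<^sup>2 * ((opnorm E A)\<^sup>2 * (hnorm T S)\<^sup>2)"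
    unfolding infsum_cmult_right' by (rule mult_left_mono[OF order_trans[OF s4(2) s3']]) simp
  finally have s7: "(\<Sum>\<^sub>\<infinity>b\<in>?B. (hnorm K (X (?R b)))\<^sup>2) \<le> (opnorm K X * opnorm E A * hnorm T S)\<^sup>2"
    by (simp add: power_mult_distrib mult.assoc)
  have nn: "0 \<le> opnorm K X" "0 \<le> opnorm E A" "0 \<le> opnorm E (adj E A)" "0 \<le> hnorm T S"
    using X A S by (auto intro: K.opnorm_nonneg E.opnorm_nonneg)
  show in_T: "op_tensor K E X A S \<in> carrier T"
  \<comment> \<open>This constant bounds the values of the image as a map from E to K; the
    Hilbert-Schmidt norm is estimated separately by \<open>s7\<close>.\<close>
  proof (rule tensor_inI[where c = "opnorm K X * hnorm T S * opnorm E (adj E A)"])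
    fix v assume v: "v \<in> carrier E"
    have "hnorm K (X (?R v)) \<le> opnorm K X * hnorm K (?R v)"
      using X A S v by (intro K.hnorm_le_opnorm) auto
    also have "\<dots> \<le> opnorm K X * (hnorm T S * hnorm E (adj E A v))"
      using A S v nn by (intro mult_left_mono tensor_pointwise_bound) auto
    also have "\<dots> \<le> opnorm K X * (hnorm T S * (opnorm E (adj E A) * hnorm E v))"
      using A v nn by (intro mult_left_mono E.hnorm_le_opnorm) auto
    finally show "hnorm K (op_tensor K E X A S v) \<le> opnorm K X * hnorm T S * opnorm E (adj E A) * hnorm E v"
      using v S by (simp add: op_tensor_apply mult.assoc)
  next
    show "(\<lambda>b. (hnorm K (op_tensor K E X A S b))\<^sup>2) summable_on ?B"
      using s6 by (rule summable_on_cong[THEN iffD1, rotated]) (use S in \<open>simp add: op_tensor_apply\<close>)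
  next
    show "op_tensor K E X A S v = undefined" if "v \<notin> carrier E" for v
      using that S by (simp add: op_tensor_def)
  qed (use X A S in \<open>auto simp: op_tensor_apply E.op_add E.op_smult tensor_add tensor_smult
      K.op_add K.op_smult K.cinner_simps\<close>)
  have eq: "(hnorm T (op_tensor K E X A S))\<^sup>2 = (\<Sum>\<^sub>\<infinity>b\<in>?B. (hnorm K (X (?R b)))\<^sup>2)"
    unfolding tensor_hnorm_sq[OF in_T] by (intro infsum_cong) (use S in \<open>simp add: op_tensor_apply\<close>)
  show "hnorm T (op_tensor K E X A S) \<le> opnorm K X * opnorm E A * hnorm T S"
  proof (rule power2_le_imp_le)
    show "(hnorm T (op_tensor K E X A S))\<^sup>2 \<le> (opnorm K X * opnorm E A * hnorm T S)\<^sup>2"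
      unfolding eq by (rule s7)
    show "0 \<le> opnorm K X * opnorm E A * hnorm T S"
      by (intro mult_nonneg_nonneg nn)
  qed
qed

lemma op_tensor_in:
  assumes X: "X \<in> carrier (bounded_ops K)" and A: "A \<in> carrier (bounded_ops E)"
  shows "op_tensor K E X A \<in> carrier (bounded_ops T)"
proof (rule T.op_inI[where c = "opnorm K X * opnorm E A"])
  note maps = op_tensor_maps[OF X A]
  show "op_tensor K E X A S = undefined" if "S \<notin> carrier T" for S
    using that by (simp add: op_tensor_def)
  show "cinner T (op_tensor K E X A (S \<oplus>\<^bsub>T\<^esub> S')) Z = cinner T (op_tensor K E X A S) Z + cinner T (op_tensor K E X A S') Z"
    if SS: "S \<in> carrier T" "S' \<in> carrier T" "Z \<in> carrier T" for S S' Z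
  proof -
    have "op_tensor K E X A (S \<oplus>\<^bsub>T\<^esub> S') = op_tensor K E X A S \<oplus>\<^bsub>T\<^esub> op_tensor K E X A S'"
      by (rule tensor_eqI) (use SS X A maps in \<open>auto simp: op_tensor_apply tensor_apply K.op_add\<close>)
    then show ?thesis using SS maps by (simp add: T.cinner_simps)
  qed
  show "cinner T (op_tensor K E X A (a \<odot>\<^bsub>T\<^esub> S)) Z = a * cinner T (op_tensor K E X A S) Z"
    if SS: "S \<in> carrier T" "Z \<in> carrier T" for a S Z
  proof -
    have "op_tensor K E X A (a \<odot>\<^bsub>T\<^esub> S) = a \<odot>\<^bsub>T\<^esub> op_tensor K E X A S"
      by (rule tensor_eqI) (use SS X A maps in \<open>auto simp: op_tensor_apply tensor_apply K.op_smult\<close>)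
    then show ?thesis using SS maps by (simp add: T.cinner_simps)
  qed
qed (use op_tensor_maps[OF X A] in auto)

lemma op_tensor_smult:
  assumes X: "X \<in> carrier (bounded_ops K)" and A: "A \<in> carrier (bounded_ops E)"
  shows "op_tensor K E (a \<odot>\<^bsub>bounded_ops K\<^esub> X) A = a \<odot>\<^bsub>bounded_ops T\<^esub> op_tensor K E X A"
proof (rule T.op_eqI)
  have aX: "a \<odot>\<^bsub>bounded_ops K\<^esub> X \<in> carrier (bounded_ops K)" using X by auto
  show "op_tensor K E (a \<odot>\<^bsub>bounded_ops K\<^esub> X) A \<in> carrier (bounded_ops T)"
    by (rule op_tensor_in[OF aX A])
  show "a \<odot>\<^bsub>bounded_ops T\<^esub> op_tensor K E X A \<in> carrier (bounded_ops T)"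
    using op_tensor_in[OF X A] by auto
  fix S Z assume SZ: "S \<in> carrier T" "Z \<in> carrier T"
  have "op_tensor K E (a \<odot>\<^bsub>bounded_ops K\<^esub> X) A S = a \<odot>\<^bsub>T\<^esub> op_tensor K E X A S"
    by (rule tensor_eqI)
      (use SZ X A aX op_tensor_maps[OF X A] op_tensor_maps[OF aX A] in
        \<open>auto simp: op_tensor_apply tensor_apply K.smult_op_apply\<close>)
  then show "cinner T (op_tensor K E (a \<odot>\<^bsub>bounded_ops K\<^esub> X) A S) Z = cinner T ((a \<odot>\<^bsub>bounded_ops T\<^esub> op_tensor K E X A) S) Z"
    using SZ by (simp add: T.smult_op_apply)
qed

end

section \<open>Harnack's inequality for power series\<close>

lemma Harnack_right_half_plane:
  fixes G :: "complex \<Rightarrow> complex"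
  assumes hol: "G holomorphic_on ball 0 1"
    and pos: "\<And>z. norm z < 1 \<Longrightarrow> 0 < Re (G z)"
    and G0: "G 0 = of_real c" and w: "norm w < 1"
  shows "(1 - norm w) * c \<le> (1 + norm w) * Re (G w)" "(1 - norm w) * Re (G w) \<le> (1 + norm w) * c"
proof -
  have c: "c > 0" using pos[of 0] G0 by simp
  have ne: "G z + of_real c \<noteq> 0" if "norm z < 1" for z
  proof
    assume "G z + of_real c = 0"
    then have "Re (G z) + c = 0" by (simp add: complex_eq_iff)
    then show False using pos[OF that] c by simp
  qed
  define \<phi> where "\<phi> z = (G z - of_real c) / (G z + of_real c)" for z
  have "norm (\<phi> w) \<le> norm w"
  proof (rule Schwarz_Lemma(1))
    show "\<phi> holomorphic_on ball 0 1"
      unfolding \<phi>_def using ne by (intro holomorphic_intros hol) auto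
    show "\<phi> 0 = 0" by (simp add: \<phi>_def G0)
    show "norm (\<phi> z) < 1" if z: "norm z < 1" for z
    proof -
      \<comment> \<open>The squares differ by 4 c Re (G z), which is positive.\<close>
      have "(norm (G z - of_real c))\<^sup>2 < (norm (G z + of_real c))\<^sup>2"
        using mult_pos_pos[OF pos[OF z] c] unfolding cmod_power2
        by (simp add: power2_eq_square algebra_simps)
      then have "norm (G z - of_real c) < norm (G z + of_real c)"
        by (rule power_less_imp_less_base) simp
      then show ?thesis using ne[OF z] by (simp add: \<phi>_def norm_divide)
    qed
  qed (rule w)
  then have "norm (G w - of_real c) \<le> norm w * norm (G w + of_real c)"
    using ne[OF w] by (simp add: \<phi>_def norm_divide divide_le_eq)
  from power_mono[OF this norm_ge_zero, of 2]
  have "(norm (G w - of_real c))\<^sup>2 \<le> (norm w)\<^sup>2 * (norm (G w + of_real c))\<^sup>2"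
    by (simp add: power_mult_distrib)
  then have "(Re (G w) - c)\<^sup>2 + (Im (G w))\<^sup>2 \<le> (norm w)\<^sup>2 * (Re (G w) + c)\<^sup>2 + (norm w)\<^sup>2 * (Im (G w))\<^sup>2"
    by (simp add: cmod_power2 distrib_left)
  \<comment> \<open>As |w| < 1, the imaginary term on the right is at most the one on the left, and
    cancelling it leaves an inequality between real parts alone.\<close>
  moreover have "(norm w)\<^sup>2 * (Im (G w))\<^sup>2 \<le> 1 * (Im (G w))\<^sup>2"
    using w by (intro mult_right_mono) (auto simp: power_le_one)
  ultimately have "(Re (G w) - c)\<^sup>2 \<le> (norm w * (Re (G w) + c))\<^sup>2"
    by (simp add: power_mult_distrib)
  \<comment> \<open>The two signs of the absolute value are the two halves of Harnack's
    inequality.\<close>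
  then have "\<bar>Re (G w) - c\<bar> \<le> norm w * (Re (G w) + c)"
    using pos[OF w] c by (simp add: abs_le_square_iff[symmetric] abs_mult)
  then show "(1 - norm w) * c \<le> (1 + norm w) * Re (G w)" "(1 - norm w) * Re (G w) \<le> (1 + norm w) * c"
    by (simp_all add: algebra_simps abs_le_iff)
qed

text \<open>\<open>Harnack_right_half_plane\<close> asks for a strictly positive real part and a
  real value at 0. Subtracting \<i> Im (F 0) and adding e / 2 secures both, and the dependence on e
  vanishes in the limit.\<close>

lemma Harnack_power_series:
  fixes a :: "nat \<Rightarrow> complex"
  assumes sums: "\<And>z. norm z < 1 \<Longrightarrow> (\<lambda>k. a k * z ^ k) sums F z"
    and pos: "\<And>z. norm z < 1 \<Longrightarrow> 0 \<le> Re (F z)"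
    and w: "norm w < 1"
  shows "(1 - norm w) * Re (F 0) \<le> (1 + norm w) * Re (F w)"
    "(1 - norm w) * Re (F w) \<le> (1 + norm w) * Re (F 0)"
proof -
  have hol: "F holomorphic_on ball 0 1"
    by (rule power_series_holomorphic[of _ _ a]) (use sums in simp)
  have "(1 - norm w) * Re (F 0) \<le> (1 + norm w) * Re (F w) + e \<and>
    (1 - norm w) * Re (F w) \<le> (1 + norm w) * Re (F 0) + e" if e: "e > 0" for e
  proof -
    define G where "G z = F z - \<i> * of_real (Im (F 0)) + of_real (e / 2)" for z
    have Re_G: "Re (G z) = Re (F z) + e / 2" for z by (simp add: G_def)
    have "G holomorphic_on ball 0 1"
      unfolding G_def by (intro holomorphic_intros hol)
    moreover have "G 0 = of_real (Re (F 0) + e / 2)"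
      by (simp add: G_def complex_eq_iff)
    moreover have "0 < Re (G z)" if "norm z < 1" for z using pos[OF that] e by (simp add: Re_G)
    ultimately have "(1 - norm w) * (Re (F 0) + e / 2) \<le> (1 + norm w) * Re (G w)"
      "(1 - norm w) * Re (G w) \<le> (1 + norm w) * (Re (F 0) + e / 2)"
      using w by (auto intro!: Harnack_right_half_plane)
    \<comment> \<open>The shift enters with the weights 1 + |w| and 1 - |w| on the two sides, so its
      net cost is (1 + |w|) e / 2 - (1 - |w|) e / 2 = |w| e.\<close>
    moreover have "norm w * e \<le> e" using e w by (simp add: mult_left_le_one_le)
    ultimately show ?thesis by (simp add: Re_G field_simps)
  qed
  then show "(1 - norm w) * Re (F 0) \<le> (1 + norm w) * Re (F w)"
    "(1 - norm w) * Re (F w) \<le> (1 + norm w) * Re (F 0)"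
    by (auto intro: field_le_epsilon)
qed

section \<open>Dilations of operator tuples\<close>

definition dilate :: "nat \<Rightarrow> 'k hilb \<Rightarrow> complex \<Rightarrow> (nat \<Rightarrow> 'k \<Rightarrow> 'k) \<Rightarrow> (nat \<Rightarrow> 'k \<Rightarrow> 'k)" where
  "dilate n K w X = (\<lambda>i\<in>{1..n}. w \<odot>\<^bsub>bounded_ops K\<^esub> X i)"

lemma finite_words [simp]: "finite (words n k)"
  using finite_lists_length_eq[of "{1..n}" k] by (simp add: words_def)

context hilbert_space
begin

lemma tuple_in [simp]: "\<lbrakk>X \<in> op_tuples n V; i \<in> {1..n}\<rbrakk> \<Longrightarrow> X i \<in> carrier (bounded_ops V)"
  by (auto simp: op_tuples_def)

lemma dilate_apply: "i \<in> {1..n} \<Longrightarrow> dilate n V w X i = w \<odot>\<^bsub>bounded_ops V\<^esub> X i"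
  by (simp add: dilate_def)

lemma dilate_in: "X \<in> op_tuples n V \<Longrightarrow> dilate n V w X \<in> op_tuples n V"
  by (auto simp: op_tuples_def dilate_def)

lemma dilate_one:
  assumes "X \<in> op_tuples n V"
  shows "dilate n V 1 X = X"
proof (rule PiE_ext)
  show "dilate n V 1 X \<in> {1..n} \<rightarrow>\<^sub>E carrier (bounded_ops V)" "X \<in> {1..n} \<rightarrow>\<^sub>E carrier (bounded_ops V)"
    using assms dilate_in[OF assms] by (simp_all add: op_tuples_def)
  show "dilate n V 1 X i = X i" if "i \<in> {1..n}" for i
    by (rule op_eqI) (use assms that in \<open>auto simp: dilate_def cinner_smult_op\<close>)
qed

text \<open>The centre of every slice z \<mapsto> z X is the very tuple at which u(0) is
  evaluated.\<close>

lemma dilate_zero: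
  assumes "X \<in> op_tuples n V"
  shows "dilate n V 0 X = zero_tuple n V"
  unfolding dilate_def zero_tuple_def
proof (rule restrict_ext)
  show "0 \<odot>\<^bsub>bounded_ops V\<^esub> X i = \<zero>\<^bsub>bounded_ops V\<^esub>" if "i \<in> {1..n}" for i
    by (rule op_eqI) (use assms that in \<open>auto simp: cinner_smult_op cinner_zero_op\<close>)
qed

text \<open>The adjoint conjugates the scalar, so each summand acquires the factor w cnj w = |w|^2,
  and the square root in \<open>row_norm\<close> returns |w|.\<close>

lemma row_norm_dilate_le:
  assumes X: "X \<in> op_tuples n V"
  shows "row_norm n V (dilate n V w X) \<le> norm w * row_norm n V X"
proof -
  let ?g = "\<lambda>X i. X i \<otimes>\<^bsub>bounded_ops V\<^esub> adj V (X i)"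
  have g: "?g Y \<in> {1..n} \<rightarrow> carrier (bounded_ops V)" if "Y \<in> op_tuples n V" for Y
    using that by auto
  note gX = g[OF X] and gD = g[OF dilate_in[OF X]]
  have "(\<Oplus>\<^bsub>bounded_ops V\<^esub>i\<in>{1..n}. ?g (dilate n V w X) i)
      = of_real ((norm w)\<^sup>2) \<odot>\<^bsub>bounded_ops V\<^esub> (\<Oplus>\<^bsub>bounded_ops V\<^esub>i\<in>{1..n}. ?g X i)"
  proof (rule op_eqI)
    fix x y assume xy: "x \<in> carrier V" "y \<in> carrier V"
    have "cinner V (?g (dilate n V w X) i x) y = of_real ((norm w)\<^sup>2) * cinner V (?g X i x) y"
      if i: "i \<in> {1..n}" for i
      using i X xy by (simp add: dilate_def adj_smult smult_op_apply cinner_simps op_smult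
          complex_norm_square mult.assoc del: of_real_power)
    then show "cinner V ((\<Oplus>\<^bsub>bounded_ops V\<^esub>i\<in>{1..n}. ?g (dilate n V w X) i) x) y
      = cinner V ((of_real ((norm w)\<^sup>2) \<odot>\<^bsub>bounded_ops V\<^esub> (\<Oplus>\<^bsub>bounded_ops V\<^esub>i\<in>{1..n}. ?g X i)) x) y"
      using xy gX gD ops.finsum_closed[OF gX]
      by (simp add: cinner_smult_op cinner_finsum_op sum_distrib_left del: of_real_power)
  qed (use gX gD in auto)
  then have "opnorm V (\<Oplus>\<^bsub>bounded_ops V\<^esub>i\<in>{1..n}. ?g (dilate n V w X) i)
      \<le> (norm w)\<^sup>2 * opnorm V (\<Oplus>\<^bsub>bounded_ops V\<^esub>i\<in>{1..n}. ?g X i)"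
    using opnorm_smult_le[OF ops.finsum_closed[OF gX], of "of_real ((norm w)\<^sup>2)"]
    by (simp del: of_real_power)
  then show ?thesis
    unfolding row_norm_def using real_sqrt_le_mono by (fastforce simp: real_sqrt_mult)
qed

lemma word_op_in:
  assumes "X \<in> op_tuples n V" "set \<alpha> \<subseteq> {1..n}"
  shows "word_op V X \<alpha> \<in> carrier (bounded_ops V)"
  using assms by (induction \<alpha>) auto

lemma word_op_dilate:
  assumes "X \<in> op_tuples n V" "set \<alpha> \<subseteq> {1..n}"
  shows "word_op V (dilate n V w X) \<alpha> = w ^ length \<alpha> \<odot>\<^bsub>bounded_ops V\<^esub> word_op V X \<alpha>"
  using assms(2)
proof (induction \<alpha>)
  case Nil
  show ?case
    by (rule op_eqI) (auto simp: cinner_smult_op)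
next
  case (Cons i \<alpha>)
  have i: "i \<in> {1..n}" and \<alpha>: "set \<alpha> \<subseteq> {1..n}" using Cons.prems by auto
  have IH: "word_op V (dilate n V w X) \<alpha> = w ^ length \<alpha> \<odot>\<^bsub>bounded_ops V\<^esub> word_op V X \<alpha>"
    by (rule Cons.IH[OF \<alpha>])
  note W = word_op_in[OF assms(1) \<alpha>]
  show ?case
  proof (rule op_eqI)
    show "word_op V (dilate n V w X) (i # \<alpha>) \<in> carrier (bounded_ops V)"
      by (rule word_op_in[OF dilate_in[OF assms(1)] Cons.prems])
    show "w ^ length (i # \<alpha>) \<odot>\<^bsub>bounded_ops V\<^esub> word_op V X (i # \<alpha>) \<in> carrier (bounded_ops V)"
      using word_op_in[OF assms(1) Cons.prems] by auto
    fix x y assume "x \<in> carrier V" "y \<in> carrier V"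
    then show "cinner V (word_op V (dilate n V w X) (i # \<alpha>) x) y
      = cinner V ((w ^ length (i # \<alpha>) \<odot>\<^bsub>bounded_ops V\<^esub> word_op V X (i # \<alpha>)) x) y"
      using W i assms(1) by (simp add: IH dilate_apply smult_op_apply op_smult cinner_simps)
  qed
qed

end

section \<open>Power series and Harnack's inequality along the slices z \<mapsto> z X\<close>

context hilbert_pair
begin

lemma op_tensor_word_in:
  assumes "X \<in> op_tuples n K" "\<forall>k. \<forall>\<alpha>\<in>words n k. A \<alpha> \<in> carrier (bounded_ops E)" "\<alpha> \<in> words n k"
  shows "op_tensor K E (word_op K X \<alpha>) (A \<alpha>) \<in> carrier (bounded_ops T)"
  using assms by (intro op_tensor_in K.word_op_in) (auto simp: words_def)

lemma homogeneous_part_in: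
  assumes "X \<in> op_tuples n K" "\<forall>k. \<forall>\<alpha>\<in>words n k. A \<alpha> \<in> carrier (bounded_ops E)"
  shows "homogeneous_part n E A k K X \<in> carrier (bounded_ops T)"
  unfolding homogeneous_part_def using op_tensor_word_in[OF assms] by (intro T.ops.finsum_closed) auto

lemma cinner_homogeneous_part_dilate:
  assumes X: "X \<in> op_tuples n K" and A: "\<forall>k. \<forall>\<alpha>\<in>words n k. A \<alpha> \<in> carrier (bounded_ops E)"
    and S: "S \<in> carrier T" and Z: "Z \<in> carrier T"
  shows "cinner T (homogeneous_part n E A k K (dilate n K w X) S) Z
       = w ^ k * cinner T (homogeneous_part n E A k K X S) Z"
proof -
  note inX = op_tensor_word_in[OF X A, of _ k]
  note inD = op_tensor_word_in[OF K.dilate_in[OF X] A, of _ k]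
  have "op_tensor K E (word_op K (dilate n K w X) \<alpha>) (A \<alpha>)
      = w ^ k \<odot>\<^bsub>bounded_ops T\<^esub> op_tensor K E (word_op K X \<alpha>) (A \<alpha>)" if "\<alpha> \<in> words n k" for \<alpha>
    using that A K.word_op_in[OF X, of \<alpha>]
    by (simp add: words_def K.word_op_dilate[OF X] op_tensor_smult)
  then have "cinner T (op_tensor K E (word_op K (dilate n K w X) \<alpha>) (A \<alpha>) S) Z
      = w ^ k * cinner T (op_tensor K E (word_op K X \<alpha>) (A \<alpha>) S) Z" if "\<alpha> \<in> words n k" for \<alpha>
    using that S Z inX[OF that] by (simp add: T.cinner_smult_op)
  then show ?thesis
    unfolding homogeneous_part_def
    using S Z inX inD by (simp add: T.cinner_finsum_op sum_distrib_left)
qed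

text \<open>Convergence in operator norm implies convergence of every matrix entry, because |<D S,
  Z>| is at most \<open>opnorm T D\<close> times the norms of S and Z, where D is the remainder
  after N terms.\<close>

lemma sums_cinner_homogeneous_part:
  assumes X: "X \<in> op_tuples n K" and A: "\<forall>k. \<forall>\<alpha>\<in>words n k. A \<alpha> \<in> carrier (bounded_ops E)"
    and S: "S \<in> carrier T" and Z: "Z \<in> carrier T" and f: "f \<in> carrier (bounded_ops T)"
    and lim: "(\<lambda>N. opnorm T (f \<ominus>\<^bsub>bounded_ops T\<^esub>
               (\<Oplus>\<^bsub>bounded_ops T\<^esub>k\<in>{..<N}. homogeneous_part n E A k K X))) \<longlonglongrightarrow> 0"
  shows "(\<lambda>k. cinner T (homogeneous_part n E A k K X S) Z) sums cinner T (f S) Z"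
  unfolding sums_def
proof (rule Lim_transform[OF tendsto_const])
  let ?P = "\<lambda>N. \<Oplus>\<^bsub>bounded_ops T\<^esub>k\<in>{..<N}. homogeneous_part n E A k K X"
  note hom = homogeneous_part_in[OF X A]
  have P: "?P N \<in> carrier (bounded_ops T)" for N
    using hom by (intro T.ops.finsum_closed) auto
  have "(\<lambda>N. opnorm T (f \<ominus>\<^bsub>bounded_ops T\<^esub> ?P N) * (hnorm T S * hnorm T Z)) \<longlonglongrightarrow> 0"
    using tendsto_mult_right[OF lim] by simp
  then show "(\<lambda>N. (\<Sum>k<N. cinner T (homogeneous_part n E A k K X S) Z) - cinner T (f S) Z) \<longlonglongrightarrow> 0"
  proof (rule Lim_null_comparison[rotated], intro always_eventually allI)
    fix N
    let ?D = "f \<ominus>\<^bsub>bounded_ops T\<^esub> ?P N"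
    have D: "?D \<in> carrier (bounded_ops T)" using f P by (rule T.ops.minus_closed)
    have "(\<Sum>k<N. cinner T (homogeneous_part n E A k K X S) Z) = cinner T (?P N S) Z"
      using hom S Z by (simp add: T.cinner_finsum_op)
    then have "norm ((\<Sum>k<N. cinner T (homogeneous_part n E A k K X S) Z) - cinner T (f S) Z)
        = norm (cinner T (?D S) Z)"
      using f P S Z by (simp add: T.cinner_diff_op norm_minus_commute)
    also have "\<dots> \<le> hnorm T (?D S) * hnorm T Z"
      using D S Z by (intro T.Cauchy_Schwarz) auto
    also have "\<dots> \<le> opnorm T ?D * hnorm T S * hnorm T Z"
      using D S Z by (intro mult_right_mono T.hnorm_le_opnorm) auto
    finally show "norm ((\<Sum>k<N. cinner T (homogeneous_part n E A k K X S) Z) - cinner T (f S) Z)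
        \<le> opnorm T ?D * (hnorm T S * hnorm T Z)" by (simp add: mult.assoc)
  qed
qed

lemma Harnack_pluriharmonic:
  fixes u :: "('k, 'e) free_function"
  assumes u: "free_pluriharmonic n E u" and pos: "positive_free_function n E u"
    and r: "0 \<le> r" "r < 1" and X: "X \<in> closed_op_ball n K r" and S: "S \<in> carrier T"
  shows "(1 - r) * Re (cinner T (u K (zero_tuple n K) S) S) \<le> (1 + r) * Re (cinner T (u K X S) S)"
    "(1 - r) * Re (cinner T (u K X S) S) \<le> (1 + r) * Re (cinner T (u K (zero_tuple n K) S) S)"
proof -
  have Xt: "X \<in> op_tuples n K" and Xr: "row_norm n K X \<le> r" using X by (auto simp: closed_op_ball_def)
  obtain f :: "('k, 'e) free_function" where hol: "free_holomorphic n E f"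
    and uf': "\<forall>K. hilbert_space K \<longrightarrow> (\<forall>X\<in>open_op_ball n K.
      u K X = (1/2) \<odot>\<^bsub>bounded_ops (hilb_tensor K E)\<^esub>
        (f K X \<oplus>\<^bsub>bounded_ops (hilb_tensor K E)\<^esub> adj (hilb_tensor K E) (f K X)))"
    using u unfolding free_pluriharmonic_def by blast
  note uf = uf'[rule_format, OF K.hilbert_space_axioms]
  obtain A where "free_coefficients n E A"
    and ser: "\<forall>K. hilbert_space K \<longrightarrow> (\<forall>X\<in>open_op_ball n K.
      f K X \<in> carrier (bounded_ops (hilb_tensor K E)) \<and>
      (\<lambda>N. opnorm (hilb_tensor K E) (f K X \<ominus>\<^bsub>bounded_ops (hilb_tensor K E)\<^esub>
        (\<Oplus>\<^bsub>bounded_ops (hilb_tensor K E)\<^esub>k\<in>{..<N}. homogeneous_part n E A k K X)))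
      \<longlonglongrightarrow> 0)"
    using hol unfolding free_holomorphic_def by blast
  then have A: "\<forall>k. \<forall>\<alpha>\<in>words n k. A \<alpha> \<in> carrier (bounded_ops E)"
    by (simp add: free_coefficients_def)
  note f = ser[rule_format, OF K.hilbert_space_axioms, THEN conjunct1]
    and lim = ser[rule_format, OF K.hilbert_space_axioms, THEN conjunct2]
  \<comment> \<open>The adjoint of f contributes the complex conjugate of <f S, S>, so half the sum
    has the same real part as <f S, S>.\<close>
  have Re_u: "Re (cinner T (u K Y S) S) = Re (cinner T (f K Y S) S)" if Y: "Y \<in> open_op_ball n K" for Y
  proof -
    have "cinner T (S) (f K Y S) = cnj (cinner T (f K Y S) S)"
      using f[OF Y] S by (intro T.cinner_commute) auto
    then show ?thesis
      using f[OF Y] S by (simp add: uf[OF Y] T.cinner_smult_op T.cinner_add_op T.cinner_adj')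
  qed
  have pos': "0 \<le> Re (cinner T (u K Y S) S)" if "Y \<in> open_op_ball n K" for Y
    using pos that S K.hilbert_space_axioms unfolding positive_free_function_def positive_op_def by blast
  have bounds: "(1 - s) * Re (cinner T (u K (zero_tuple n K) S) S) \<le> (1 + s) * Re (cinner T (u K X S) S)
    \<and> (1 - s) * Re (cinner T (u K X S) S) \<le> (1 + s) * Re (cinner T (u K (zero_tuple n K) S) S)"
    if s: "r < s" "s < 1" for s
  proof -
    \<comment> \<open>Division by s normalises the disc to |z| < 1 and places X at z = s. There the
      row norm of \<open>Y z\<close> is at most r / s < 1.\<close>
    define Y where "Y z = dilate n K (z / of_real s) X" for z :: complex
    have Yt: "Y z \<in> op_tuples n K" for z unfolding Y_def by (rule K.dilate_in[OF Xt])
    have Y: "Y z \<in> open_op_ball n K" if z: "norm z < 1" for z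
    proof -
      have "row_norm n K (Y z) \<le> norm z / s * row_norm n K X"
        using K.row_norm_dilate_le[OF Xt, of "z / of_real s"] s r by (simp add: Y_def norm_divide)
      also have "\<dots> \<le> norm z / s * r" using s r Xr by (intro mult_left_mono) auto
      also have "\<dots> \<le> 1 / s * r" using z s r by (intro mult_right_mono divide_right_mono) auto
      also have "\<dots> < 1" using s r by simp
      finally show ?thesis using Yt by (simp add: open_op_ball_def)
    qed
    define F where "F z = cinner T (f K (Y z) S) S" for z
    \<comment> \<open>The power of s compensates for the dilation by z / s: the k-th homogeneous
      part at \<open>Y z\<close> is (z / s)^k times the one at X.\<close>
    define a where "a k = cinner T (homogeneous_part n E A k K X S) S / of_real s ^ k" for k
    have sums: "(\<lambda>k. a k * z ^ k) sums F z" if z: "norm z < 1" for z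
    proof -
      have "(\<lambda>k. cinner T (homogeneous_part n E A k K (Y z) S) S) sums F z"
        unfolding F_def by (rule sums_cinner_homogeneous_part[OF Yt A S S f[OF Y[OF z]] lim[OF Y[OF z]]])
      then show ?thesis
        unfolding Y_def cinner_homogeneous_part_dilate[OF Xt A S S]
        by (simp add: a_def power_divide mult.commute)
    qed
    have Fpos: "0 \<le> Re (F z)" if "norm z < 1" for z
      using pos'[OF Y[OF that]] Re_u[OF Y[OF that]] by (simp add: F_def)
    have s1: "norm (complex_of_real s) < 1" "norm (complex_of_real s) = s" using s r by auto
    have Ys: "Y (of_real s) = X" using s r Xt by (simp add: Y_def K.dilate_one)
    have Y0: "Y 0 = zero_tuple n K" using Xt by (simp add: Y_def K.dilate_zero)
    have "Re (F 0) = Re (cinner T (u K (zero_tuple n K) S) S)"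
      using Re_u[OF Y[of 0]] by (simp add: F_def Y0)
    moreover have "Re (F (of_real s)) = Re (cinner T (u K X S) S)"
      using Re_u[OF Y[OF s1(1)]] by (simp add: F_def Ys)
    ultimately show ?thesis
      using Harnack_power_series[OF sums Fpos s1(1)] unfolding s1(2) by simp
  qed
  \<comment> \<open>Since r < 1, every s close enough to r from the right is admissible, and both
    sides of the bounds are continuous in s.\<close>
  have ev: "\<forall>\<^sub>F s in at_right r. r < s \<and> s < 1"
    using r by (auto simp: eventually_at_right)
  have limit: "(1 - r) * x \<le> (1 + r) * y"
    if "\<And>s. r < s \<Longrightarrow> s < 1 \<Longrightarrow> (1 - s) * x \<le> (1 + s) * y" for x y
  proof (rule tendsto_le)
    show "((\<lambda>s. (1 - s) * x) \<longlongrightarrow> (1 - r) * x) (at_right r)"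
      "((\<lambda>s. (1 + s) * y) \<longlongrightarrow> (1 + r) * y) (at_right r)"
      by (auto intro!: tendsto_eq_intros)
    show "\<forall>\<^sub>F s in at_right r. (1 - s) * x \<le> (1 + s) * y"
      using ev by eventually_elim (use that in auto)
  qed simp
  show "(1 - r) * Re (cinner T (u K (zero_tuple n K) S) S) \<le> (1 + r) * Re (cinner T (u K X S) S)"
    "(1 - r) * Re (cinner T (u K X S) S) \<le> (1 + r) * Re (cinner T (u K (zero_tuple n K) S) S)"
    using bounds by (auto intro!: limit)
qed

end

text \<open>The forms of P and Q are real because both operators are positive, and b and c are real.
  The imaginary part of the form of the difference thus vanishes, and comparing real parts is
  enough.\<close>

lemma (in hilbert_space) op_leI:
  assumes P: "positive_op V P" and Q: "positive_op V Q"
    and le: "\<And>x. x \<in> carrier V \<Longrightarrow> b * Re (cinner V (P x) x) \<le> c * Re (cinner V (Q x) x)"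
  shows "op_le V (complex_of_real b \<odot>\<^bsub>bounded_ops V\<^esub> P) (complex_of_real c \<odot>\<^bsub>bounded_ops V\<^esub> Q)"
proof -
  have in_ops: "P \<in> carrier (bounded_ops V)" "Q \<in> carrier (bounded_ops V)"
    using P Q by (auto simp: positive_op_def)
  show ?thesis
    unfolding op_le_def positive_op_def
    using P Q in_ops le by (auto simp: positive_op_def cinner_diff_op cinner_smult_op)
qed

theorem theorem1p4:
  fixes n :: nat and r :: real
    and H :: "'k hilb" and E :: "'e hilb"
    and u :: "('k, 'e) free_function"
    and X :: "nat \<Rightarrow> 'k \<Rightarrow> 'k"
  assumes "n \<ge> 1"
    and "hilbert_space H"
    and "separable_hilbert_space E"
    and "free_pluriharmonic n E u"
    and "positive_free_function n E u"
    and "0 \<le> r" and "r < 1"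
    and "X \<in> closed_op_ball n H r"
  shows "op_le (hilb_tensor H E)
           (complex_of_real ((1 - r) / (1 + r))
              \<odot>\<^bsub>bounded_ops (hilb_tensor H E)\<^esub> u H (zero_tuple n H))
           (u H X)
       \<and> op_le (hilb_tensor H E)
           (u H X)
           (complex_of_real ((1 + r) / (1 - r))
              \<odot>\<^bsub>bounded_ops (hilb_tensor H E)\<^esub> u H (zero_tuple n H))"
proof -
  interpret hilbert_pair H E
    using assms(2,3) by (simp add: hilbert_pair_def separable_hilbert_space_def)
  have Xt: "X \<in> op_tuples n H" and Xr: "row_norm n H X \<le> r"
    using assms(8) by (auto simp: closed_op_ball_def)
  \<comment> \<open>The zero tuple is the dilation of X by 0, so its row norm is at most 0 times
    that of X.\<close>
  have "row_norm n H (zero_tuple n H) \<le> 0"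
    using K.row_norm_dilate_le[OF Xt, of 0] K.dilate_zero[OF Xt] by simp
  then have "zero_tuple n H \<in> open_op_ball n H"
    using K.dilate_in[OF Xt, of 0] K.dilate_zero[OF Xt] by (simp add: open_op_ball_def)
  moreover have "X \<in> open_op_ball n H" using Xt Xr assms(7) by (simp add: open_op_ball_def)
  ultimately have pos: "positive_op T (u H (zero_tuple n H))" "positive_op T (u H X)"
    using assms(2,5) by (auto simp: positive_free_function_def)
  \<comment> \<open>Writing \<open>u H X\<close> with the scalar 1 in front lets
    \<open>op_leI\<close>, which has a real factor on either side, serve both inequalities.\<close>
  then have one: "complex_of_real 1 \<odot>\<^bsub>bounded_ops T\<^esub> u H X = u H X"
    by (intro T.op_eqI) (auto simp: positive_op_def T.cinner_smult_op)
  note harnack = Harnack_pluriharmonic[OF assms(4-8)]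
  have "op_le T (complex_of_real ((1 - r) / (1 + r)) \<odot>\<^bsub>bounded_ops T\<^esub> u H (zero_tuple n H))
      (complex_of_real 1 \<odot>\<^bsub>bounded_ops T\<^esub> u H X)"
    using harnack(1) assms(6) by (intro T.op_leI pos) (simp add: divide_le_eq mult.commute)
  moreover have "op_le T (complex_of_real 1 \<odot>\<^bsub>bounded_ops T\<^esub> u H X)
      (complex_of_real ((1 + r) / (1 - r)) \<odot>\<^bsub>bounded_ops T\<^esub> u H (zero_tuple n H))"
    using harnack(2) assms(7) by (intro T.op_leI pos) (simp add: le_divide_eq mult.commute)
  ultimately show ?thesis unfolding one by simp
qed

end
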